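(* Let $\Omega$ be a countably infinite set and $E=\mathrm{Self}(\Omega)$. Let $M\subseteq E$ be a submonoid that is closed in the function topology, has large stabilizers, and has dense a.e. injective maps. Then $M$ satisfies exactly one of the following five conditions: (i) $M_{(\Sigma)}$ has an infinite forward orbit for every finite $\Sigma\subseteq\Omega$; (ii) there exists a finite $\Sigma\subseteq\Omega$ such that all forward orbits of $M_{(\Sigma)}$ are finite, but for every finite $\Sigma\subseteq\Omega$ the cardinalities of the forward orbits of $M_{(\Sigma)}$ have no common finite bound; (iii) there exist a finite $\Sigma\subseteq\Omega$ and a positive integer $n$ such that all forward orbits of $M_{(\Sigma)}$ have cardinality at most $n$, but for all finite $\Gamma,\Delta\subseteq\Omega$ there exists $\alpha\in\Omega$ with $(\alpha)M_{(\Delta)}\not\subseteq\Gamma\cup\{\alpha\}$; (iv) there exist finite $\Gamma,\Delta\subseteq\Omega$ such that $(\alpha)M_{(\Delta)}\subseteq\Gamma\cup\{\alpha\}$ for all $\alpha\in\Omega$, but $M_{(\Sigma)}\neq\{1\}$ for every finite $\Sigma\subseteq\Omega$; (v) there exists a finite $\Sigma\subseteq\Omega$ with $M_{(\Sigma)}=\{1\}$. Moreover, if $M,M'$ are two such submonoids (closed, with large stabilizers and dense a.e. injective maps), then $M\approx M'$ if and only if they satisfy the same one of conditions (i)–(v); thus these monoids fall into exactly five $\approx$-equivalence classes.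
   Context: $\mathrm{Self}(\Omega)$ is the monoid of maps $\Omega\to\Omega$, maps written on the right of arguments, composed left to right. The function topology on $E$ has subbasis $\{f:(\alpha)f=\beta\}$ ($\alpha,\beta\in\Omega$). $\langle X\rangle$ is the submonoid generated by $X$. For submonoids $M_1,M_2$, $M_1\approx M_2$ means there exist finite $U,V\subseteq E$ with $M_1\subseteq\langle M_2\cup U\rangle$ and $M_2\subseteq\langle M_1\cup V\rangle$. For $U\subseteq E$ and $\Sigma\subseteq\Omega$, $U_{(\Sigma)}=\{f\in U:(\alpha)f=\alpha\text{ for all }\alpha\in\Sigma\}$. The forward orbit of $\alpha$ under $U$ is $(\alpha)U=\{(\alpha)f:f\in U\}$. $M$ has large stabilizers if $M_{(\Sigma)}\approx M$ for every finite $\Sigma\subseteq\Omega$. A map $f$ is a.e. injective if it is injective on $\Omega\setminus\Gamma$ for some finite $\Gamma$; $M$ has dense a.e. injective maps if the a.e. injective elements of $M$ form a dense subset of $M$ in the function topology. *)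

theory Defs
  imports "HOL-Analysis.Analysis" "HOL-Algebra.Group"
begin

(* The set Omega is the whole type 'a; that it is countably infinite is assumed in the theorem. *)

(* Maps act on the right of their arguments, so the product f g means "first f, then g". *)
definition self_monoid :: "('a \<Rightarrow> 'a) monoid" where
  "self_monoid = \<lparr>carrier = UNIV, mult = (\<lambda>f g. g \<circ> f), one = id\<rparr>"

definition generated_submonoid :: "('a \<Rightarrow> 'a) set \<Rightarrow> ('a \<Rightarrow> 'a) set" where
  "generated_submonoid X = (\<lambda>N. submonoid N self_monoid) hull X"

definition function_topology :: "('a \<Rightarrow> 'a) topology" where
  "function_topology = topology_generated_by {{f. f \<alpha> = \<beta>} | \<alpha> \<beta>. True}"

definition monoid_equiv :: "('a \<Rightarrow> 'a) set \<Rightarrow> ('a \<Rightarrow> 'a) set \<Rightarrow> bool" where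
  "monoid_equiv M1 M2 \<longleftrightarrow>
     (\<exists>U V. finite U \<and> finite V \<and>
        M1 \<subseteq> generated_submonoid (M2 \<union> U) \<and> M2 \<subseteq> generated_submonoid (M1 \<union> V))"

definition pw_stabilizer :: "('a \<Rightarrow> 'a) set \<Rightarrow> 'a set \<Rightarrow> ('a \<Rightarrow> 'a) set" where
  "pw_stabilizer U S = {f \<in> U. \<forall>\<alpha>\<in>S. f \<alpha> = \<alpha>}"

definition forward_orbit :: "'a \<Rightarrow> ('a \<Rightarrow> 'a) set \<Rightarrow> 'a set" where
  "forward_orbit \<alpha> U = {f \<alpha> | f. f \<in> U}"

definition large_stabilizers :: "('a \<Rightarrow> 'a) set \<Rightarrow> bool" where
  "large_stabilizers M \<longleftrightarrow> (\<forall>S. finite S \<longrightarrow> monoid_equiv (pw_stabilizer M S) M)"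

definition ae_injective :: "('a \<Rightarrow> 'a) \<Rightarrow> bool" where
  "ae_injective f \<longleftrightarrow> (\<exists>\<Gamma>. finite \<Gamma> \<and> inj_on f (UNIV - \<Gamma>))"

definition dense_ae_injective :: "('a \<Rightarrow> 'a) set \<Rightarrow> bool" where
  "dense_ae_injective M \<longleftrightarrow>
     subtopology function_topology M closure_of {f \<in> M. ae_injective f} = M"

definition admissible :: "('a \<Rightarrow> 'a) set \<Rightarrow> bool" where
  "admissible M \<longleftrightarrow> submonoid M self_monoid \<and> closedin function_topology M \<and>
     large_stabilizers M \<and> dense_ae_injective M"

(* Since card of an infinite set is 0, finiteness has to be part of the bound. *)
definition orbits_bounded :: "('a \<Rightarrow> 'a) set \<Rightarrow> nat \<Rightarrow> bool" where
  "orbits_bounded U n \<longleftrightarrow> (\<forall>\<alpha>. finite (forward_orbit \<alpha> U) \<and> card (forward_orbit \<alpha> U) \<le> n)"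

datatype label = I | II | III | IV | V

fun satisfies :: "label \<Rightarrow> ('a \<Rightarrow> 'a) set \<Rightarrow> bool" where
  "satisfies I M \<longleftrightarrow>
     (\<forall>S. finite S \<longrightarrow> (\<exists>\<alpha>. infinite (forward_orbit \<alpha> (pw_stabilizer M S))))"
| "satisfies II M \<longleftrightarrow>
     (\<exists>S. finite S \<and> (\<forall>\<alpha>. finite (forward_orbit \<alpha> (pw_stabilizer M S)))) \<and>
     (\<forall>S. finite S \<longrightarrow> \<not> (\<exists>n. orbits_bounded (pw_stabilizer M S) n))"
| "satisfies III M \<longleftrightarrow>
     (\<exists>S n. finite S \<and> n > 0 \<and> orbits_bounded (pw_stabilizer M S) n) \<and>
     (\<forall>\<Gamma> \<Delta>. finite \<Gamma> \<and> finite \<Delta> \<longrightarrow>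
        (\<exists>\<alpha>. \<not> forward_orbit \<alpha> (pw_stabilizer M \<Delta>) \<subseteq> \<Gamma> \<union> {\<alpha>}))"
| "satisfies IV M \<longleftrightarrow>
     (\<exists>\<Gamma> \<Delta>. finite \<Gamma> \<and> finite \<Delta> \<and>
        (\<forall>\<alpha>. forward_orbit \<alpha> (pw_stabilizer M \<Delta>) \<subseteq> \<Gamma> \<union> {\<alpha>})) \<and>
     (\<forall>S. finite S \<longrightarrow> pw_stabilizer M S \<noteq> {id})"
| "satisfies V M \<longleftrightarrow> (\<exists>S. finite S \<and> pw_stabilizer M S = {id})"

end

theory Submission
  imports Defs
begin

text \<open>
  Write \<open>M \<lessapprox> N\<close> if \<open>M\<close> lies in a monoid generated by \<open>N\<close> and finitely many further maps. The five classes
  are compared with model monoids: all maps; the products of finite, and of uniformly bounded, sets of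
  admissible values; the maps moving points only into a fixed finite set; the trivial monoid.

  That a monoid generates the models of its class rests on a tree construction: one picks points
  \<open>\<alpha>\<^sub>0, \<alpha>\<^sub>1, \<dots>\<close> such that the value at \<open>\<alpha>\<^sub>i\<close> of an a.e. injective element can still be chosen in enough ways
  after its values at earlier points have been prescribed, and a map \<open>b\<close> that reads off the choices. Since
  the monoid is closed, each sequence of choices is realised by an element \<open>g\<close>, and any \<open>f\<close> in the
  model is the composite of \<open>w\<^sub>i \<mapsto> \<alpha>\<^sub>i\<close>, a suitable \<open>g\<close> and \<open>b\<close>. Large stabilizers give the converse.

  The models of different classes are inequivalent by diagonalisation: the values of a word in the smaller
  monoid and finitely many extra maps are confined to sets depending only on the word's length, or, for the
  two smallest models, the word agrees with one of countably many maps up to finitely many values.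
\<close>

section \<open>Generation up to finitely many extra maps\<close>

lemma submonoid_self_monoid_iff:
  "submonoid N self_monoid \<longleftrightarrow> id \<in> N \<and> (\<forall>f\<in>N. \<forall>g\<in>N. g \<circ> f \<in> N)"
  by (auto simp: submonoid_def self_monoid_def)

lemma generated_submonoid_incl: "X \<subseteq> generated_submonoid X"
  unfolding generated_submonoid_def by (rule hull_subset)

lemma generated_submonoid_least:
  assumes "X \<subseteq> N" "id \<in> N" "\<And>f g. f \<in> N \<Longrightarrow> g \<in> N \<Longrightarrow> g \<circ> f \<in> N"
  shows "generated_submonoid X \<subseteq> N"
  unfolding generated_submonoid_def
  by (rule hull_minimal) (use assms in \<open>auto simp: submonoid_self_monoid_iff\<close>)

lemma generated_submonoid_closed:
  "id \<in> generated_submonoid X"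
  "f \<in> generated_submonoid X \<Longrightarrow> g \<in> generated_submonoid X \<Longrightarrow> g \<circ> f \<in> generated_submonoid X"
  by (auto simp: generated_submonoid_def hull_def submonoid_self_monoid_iff)

lemma generated_submonoid_mono: "X \<subseteq> Y \<Longrightarrow> generated_submonoid X \<subseteq> generated_submonoid Y"
  unfolding generated_submonoid_def by (rule hull_mono)

text \<open>Words over a countable set are countable. The diagonalisations against the two smallest
  models list all words in finitely many extra maps.\<close>

lemma countable_generated_submonoid:
  assumes "countable U"
  shows "countable (generated_submonoid U)"
proof -
  let ?N = "(\<lambda>fs. foldr (\<circ>) fs id) ` lists U"
  have comp: "foldr (\<circ>) (fs @ gs) id = foldr (\<circ>) fs id \<circ> foldr (\<circ>) gs id" for fs gs :: "('a \<Rightarrow> 'a) list"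
    by (induction fs) (auto simp: comp_assoc)
  have "generated_submonoid U \<subseteq> ?N"
  proof (rule generated_submonoid_least)
    show "U \<subseteq> ?N"
    proof
      fix u assume "u \<in> U"
      then show "u \<in> ?N" by (intro image_eqI[of _ _ "[u]"]) auto
    qed
    show "id \<in> ?N" by (intro image_eqI[of _ _ "[]"]) auto
    fix f g assume "f \<in> ?N" "g \<in> ?N"
    then obtain fs gs where "fs \<in> lists U" "gs \<in> lists U"
      "f = foldr (\<circ>) fs id" "g = foldr (\<circ>) gs id" by auto
    then show "g \<circ> f \<in> ?N" by (intro image_eqI[of _ _ "gs @ fs"]) (auto simp: comp simp del: foldr_append)
  qed
  then show ?thesis
    using assms by (meson countable_image countable_lists countable_subset)
qed

definition fin_gen_over :: "('a \<Rightarrow> 'a) set \<Rightarrow> ('a \<Rightarrow> 'a) set \<Rightarrow> bool" (infix "\<lessapprox>" 50) where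
  "M \<lessapprox> N \<longleftrightarrow> (\<exists>U. finite U \<and> M \<subseteq> generated_submonoid (N \<union> U))"

lemma monoid_equiv_iff: "monoid_equiv M N \<longleftrightarrow> M \<lessapprox> N \<and> N \<lessapprox> M"
  unfolding monoid_equiv_def fin_gen_over_def by blast

lemma fin_gen_over_subset: "M \<subseteq> N \<Longrightarrow> M \<lessapprox> N"
  unfolding fin_gen_over_def using generated_submonoid_incl[of N] by (intro exI[of _ "{}"]) auto

lemma fin_gen_over_finite: "finite M \<Longrightarrow> M \<lessapprox> N"
  unfolding fin_gen_over_def using generated_submonoid_incl[of "N \<union> M"] by (intro exI[of _ M]) auto

lemma fin_gen_over_trans [trans]:
  assumes "L \<lessapprox> M" "M \<lessapprox> N"
  shows "L \<lessapprox> N"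
proof -
  obtain U where U: "finite U" "L \<subseteq> generated_submonoid (M \<union> U)"
    using assms(1) unfolding fin_gen_over_def by blast
  obtain V where V: "finite V" "M \<subseteq> generated_submonoid (N \<union> V)"
    using assms(2) unfolding fin_gen_over_def by blast
  have "M \<union> U \<subseteq> generated_submonoid (N \<union> (U \<union> V))"
    using V(2) generated_submonoid_mono[of "N \<union> V" "N \<union> (U \<union> V)"]
      generated_submonoid_incl[of "N \<union> (U \<union> V)"] by auto
  then have "generated_submonoid (M \<union> U) \<subseteq> generated_submonoid (N \<union> (U \<union> V))"
    by (rule generated_submonoid_least) (auto intro: generated_submonoid_closed)
  with U V show ?thesis unfolding fin_gen_over_def
    by (intro exI[of _ "U \<union> V"]) auto
qed

text \<open>The maps \<open>a\<close> and \<open>b\<close> are the same for all \<open>f\<close>, so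
  these two extra generators serve the whole of \<open>K\<close>.\<close>

lemma fin_gen_over_comp:
  assumes "\<And>f. f \<in> K \<Longrightarrow> \<exists>g\<in>M. f = b \<circ> g \<circ> a"
  shows "K \<lessapprox> M"
proof -
  let ?G = "generated_submonoid (M \<union> {a, b})"
  have incl: "M \<union> {a, b} \<subseteq> ?G" by (rule generated_submonoid_incl)
  have "f \<in> ?G" if "f \<in> K" for f
  proof -
    from assms[OF that] obtain g where "g \<in> M" "f = b \<circ> g \<circ> a" by blast
    with incl show ?thesis by (auto intro!: generated_submonoid_closed)
  qed
  then show ?thesis unfolding fin_gen_over_def by (intro exI[of _ "{a, b}"]) auto
qed

section \<open>The function topology\<close>

lemma topspace_function_topology: "topspace function_topology = UNIV"
  unfolding function_topology_def by auto

lemma openin_function_topology_agree: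
  assumes "finite F"
  shows "openin function_topology {g. \<forall>x\<in>F. g x = f x}"
  using assms
proof (induction F rule: finite_induct)
  case empty
  then show ?case
    using openin_topspace[of "function_topology :: ('a \<Rightarrow> 'a) topology"]
    by (simp add: topspace_function_topology)
next
  case (insert x F)
  have "{g. \<forall>y\<in>insert x F. g y = f y} = {g. g x = f x} \<inter> {g. \<forall>y\<in>F. g y = f y}" by auto
  moreover have "openin function_topology {g. g x = f x}"
    unfolding function_topology_def openin_topology_generated_by_iff
    by (rule generate_topology_on.Basis) auto
  ultimately show ?case using insert by auto
qed

lemma openin_function_topologyD:
  assumes "openin function_topology W" "f \<in> W"
  shows "\<exists>F. finite F \<and> {g. \<forall>x\<in>F. g x = f x} \<subseteq> W"
proof -
  have "generate_topology_on {{f. f \<alpha> = \<beta>} | \<alpha> \<beta>. True} W"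
    using assms(1) unfolding function_topology_def openin_topology_generated_by_iff .
  then show ?thesis using assms(2)
  proof (induction)
    case (Int A B)
    then obtain F G where "finite F" "{g. \<forall>x\<in>F. g x = f x} \<subseteq> A" "finite G" "{g. \<forall>x\<in>G. g x = f x} \<subseteq> B"
      by auto
    then show ?case by (intro exI[of _ "F \<union> G"]) auto
  next
    case (UN K)
    then show ?case by (meson UnionE Union_upper subset_trans)
  next
    case (Basis A)
    then obtain a b where "A = {f. f a = b}" by auto
    with Basis show ?case by (intro exI[of _ "{a}"]) auto
  qed auto
qed

text \<open>Basic neighbourhoods prescribe finitely many values, so closedness is closure under
  limits in this finitary sense.\<close>

lemma closedin_function_topology_iff:
  "closedin function_topology M \<longleftrightarrow>
    (\<forall>f. (\<forall>F. finite F \<longrightarrow> (\<exists>g\<in>M. \<forall>x\<in>F. g x = f x)) \<longrightarrow> f \<in> M)"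
  (is "_ \<longleftrightarrow> ?R")
proof
  assume M: "closedin function_topology M"
  show ?R
  proof (intro allI impI, rule ccontr)
    fix f assume f: "\<forall>F. finite F \<longrightarrow> (\<exists>g\<in>M. \<forall>x\<in>F. g x = f x)" "f \<notin> M"
    have "openin function_topology (- M)"
      using M by (simp add: closedin_def topspace_function_topology Compl_eq_Diff_UNIV)
    from openin_function_topologyD[OF this, of f] f show False by blast
  qed
next
  assume R: ?R
  have "\<exists>T. openin function_topology T \<and> f \<in> T \<and> T \<subseteq> - M" if "f \<in> - M" for f
  proof -
    from R that obtain F where "finite F" "\<not> (\<exists>g\<in>M. \<forall>x\<in>F. g x = f x)" by blast
    then show ?thesis
      using openin_function_topology_agree[of F f]
      by (intro exI[of _ "{g. \<forall>x\<in>F. g x = f x}"]) auto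
  qed
  then have "openin function_topology (- M)" by (subst openin_subopen) blast
  then show "closedin function_topology M"
    by (simp add: closedin_def topspace_function_topology Compl_eq_Diff_UNIV)
qed

lemma dense_ae_injective_iff:
  "dense_ae_injective M \<longleftrightarrow>
    (\<forall>f\<in>M. \<forall>F. finite F \<longrightarrow> (\<exists>g\<in>M. ae_injective g \<and> (\<forall>x\<in>F. g x = f x)))"
  (is "_ \<longleftrightarrow> ?R")
proof -
  have "dense_ae_injective M \<longleftrightarrow>
      M \<inter> function_topology closure_of {f \<in> M. ae_injective f} = M"
    unfolding dense_ae_injective_def
    by (simp add: closure_of_subtopology Int_absorb2 Collect_conj_eq Int_assoc[symmetric])
  also have "\<dots> \<longleftrightarrow> (\<forall>f\<in>M. \<forall>T. f \<in> T \<and> openin function_topology T \<longrightarrow> (\<exists>g\<in>M. ae_injective g \<and> g \<in> T))"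
    by (auto simp: closure_of_def topspace_function_topology)
  also have "\<dots> \<longleftrightarrow> ?R"
  proof safe
    fix f F assume "\<forall>f\<in>M. \<forall>T. f \<in> T \<and> openin function_topology T \<longrightarrow> (\<exists>g\<in>M. ae_injective g \<and> g \<in> T)"
      "f \<in> M" "finite (F :: 'a set)"
    then show "\<exists>g\<in>M. ae_injective g \<and> (\<forall>x\<in>F. g x = f x)"
      using openin_function_topology_agree[of F f] by (auto dest!: bspec[of M _ f] spec[of _ "{g. \<forall>x\<in>F. g x = f x}"])
  next
    fix f T assume R: ?R and f: "f \<in> M" "openin function_topology T" "f \<in> T"
    from openin_function_topologyD[OF f(2,3)] obtain F
      where F: "finite F" "{g. \<forall>x\<in>F. g x = f x} \<subseteq> T" by blast
    from R f F obtain g where "g \<in> M" "ae_injective g" "\<forall>x\<in>F. g x = f x" by meson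
    with F show "\<exists>g\<in>M. ae_injective g \<and> g \<in> T" by blast
  qed
  finally show ?thesis .
qed

section \<open>Almost everywhere injective maps\<close>

lemma ae_injective_finite_vimage:
  assumes "ae_injective f" "finite C"
  shows "finite (f -` C)"
proof -
  obtain G where G: "finite G" "inj_on f (UNIV - G)" using assms(1) unfolding ae_injective_def by blast
  have "finite (f -` C \<inter> (UNIV - G))" using assms(2) G(2) by (rule finite_vimage_IntI)
  then show ?thesis using G(1) by (rule_tac finite_subset[of _ "(f -` C \<inter> (UNIV - G)) \<union> G"]) auto
qed

lemma ae_injective_comp:
  assumes "ae_injective f" "ae_injective g"
  shows "ae_injective (g \<circ> f)"
proof -
  obtain F G where F: "finite F" "inj_on f (UNIV - F)" and G: "finite G" "inj_on g (UNIV - G)"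
    using assms unfolding ae_injective_def by blast
  have "inj_on (g \<circ> f) (UNIV - (F \<union> f -` G))"
    using F(2) G(2) unfolding inj_on_def by auto
  moreover have "finite (F \<union> f -` G)" using F(1) ae_injective_finite_vimage[OF assms(1) G(1)] by simp
  ultimately show ?thesis unfolding ae_injective_def by blast
qed

lemma ae_injective_id: "ae_injective id"
  unfolding ae_injective_def by (intro exI[of _ "{}"]) auto

lemma ae_injective_family:
  assumes "finite A" "\<And>g. g \<in> A \<Longrightarrow> ae_injective g"
  shows "\<exists>C. finite C \<and> (\<forall>g\<in>A. inj_on g (UNIV - C))"
proof -
  obtain G where G: "\<And>g. g \<in> A \<Longrightarrow> finite (G g) \<and> inj_on g (UNIV - G g)"
    using assms(2) unfolding ae_injective_def by metis
  have "inj_on g (UNIV - (\<Union>g\<in>A. G g))" if "g \<in> A" for g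
    using G[OF that] that by (auto intro: inj_on_subset)
  moreover have "finite (\<Union>g\<in>A. G g)" using G assms(1) by auto
  ultimately show ?thesis by blast
qed

section \<open>Closed monoids with dense a.e. injective maps\<close>

text \<open>These are the properties from which the models get generated. They pass to pointwise
  stabilizers of finite sets, where the locale is interpreted again.\<close>

locale closed_monoid =
  fixes M :: "('a \<Rightarrow> 'a) set"
  assumes id_mem: "id \<in> M"
    and comp_mem: "\<And>f g. f \<in> M \<Longrightarrow> g \<in> M \<Longrightarrow> g \<circ> f \<in> M"
    and closed: "\<And>f. (\<And>F. finite F \<Longrightarrow> \<exists>g\<in>M. \<forall>x\<in>F. g x = f x) \<Longrightarrow> f \<in> M"
    and dense: "\<And>f F. f \<in> M \<Longrightarrow> finite F \<Longrightarrow> \<exists>g\<in>M. ae_injective g \<and> (\<forall>x\<in>F. g x = f x)"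

lemma closed_monoid_iff:
  "closed_monoid M \<longleftrightarrow>
    submonoid M self_monoid \<and> closedin function_topology M \<and> dense_ae_injective M"
  unfolding closed_monoid_def submonoid_self_monoid_iff closedin_function_topology_iff
    dense_ae_injective_iff by blast

lemma pw_stabilizer_pw_stabilizer: "pw_stabilizer (pw_stabilizer M S) T = pw_stabilizer M (S \<union> T)"
  by (auto simp: pw_stabilizer_def)

lemma pw_stabilizer_subset: "pw_stabilizer M S \<subseteq> M"
  by (auto simp: pw_stabilizer_def)

lemma pw_stabilizer_antimono: "S \<subseteq> T \<Longrightarrow> pw_stabilizer M T \<subseteq> pw_stabilizer M S"
  by (auto simp: pw_stabilizer_def)

lemma forward_orbit_mono: "M \<subseteq> N \<Longrightarrow> forward_orbit \<alpha> M \<subseteq> forward_orbit \<alpha> N"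
  by (auto simp: forward_orbit_def)

lemma mem_forward_orbit_iff: "\<beta> \<in> forward_orbit \<alpha> M \<longleftrightarrow> (\<exists>f\<in>M. f \<alpha> = \<beta>)"
  by (auto simp: forward_orbit_def)

context closed_monoid
begin

lemma closed_monoid_pw_stabilizer:
  assumes "finite S"
  shows "closed_monoid (pw_stabilizer M S)"
proof
  show "id \<in> pw_stabilizer M S" using id_mem by (simp add: pw_stabilizer_def)
  show "g \<circ> f \<in> pw_stabilizer M S" if "f \<in> pw_stabilizer M S" "g \<in> pw_stabilizer M S" for f g
    using that comp_mem by (simp add: pw_stabilizer_def)
  show "f \<in> pw_stabilizer M S"
    if f: "\<And>F. finite F \<Longrightarrow> \<exists>g\<in>pw_stabilizer M S. \<forall>x\<in>F. g x = f x" for f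
  proof -
    have "f \<in> M" by (rule closed) (use f pw_stabilizer_subset in blast)
    moreover have "f x = x" if "x \<in> S" for x
      using f[of "{x}"] that by (auto simp: pw_stabilizer_def)
    ultimately show ?thesis by (simp add: pw_stabilizer_def)
  qed
  \<comment> \<open>Density is applied to the finite set \<open>F \<union> S\<close>: agreeing with
    \<open>f\<close> on \<open>S\<close> too, the approximant stays in the stabilizer.\<close>
  show "\<exists>g\<in>pw_stabilizer M S. ae_injective g \<and> (\<forall>x\<in>F. g x = f x)"
    if "f \<in> pw_stabilizer M S" "finite F" for f F
    using dense[of f "F \<union> S"] that assms by (fastforce simp: pw_stabilizer_def)
qed

lemma forward_orbit_ae_injective:
  assumes "\<beta> \<in> forward_orbit \<alpha> (pw_stabilizer M D)" "finite D"
  obtains h where "h \<in> M" "ae_injective h" "\<forall>x\<in>D. h x = x" "h \<alpha> = \<beta>"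
proof -
  obtain f where f: "f \<in> M" "\<forall>x\<in>D. f x = x" "f \<alpha> = \<beta>"
    using assms(1) by (auto simp: mem_forward_orbit_iff pw_stabilizer_def)
  with dense[OF f(1), of "insert \<alpha> D"] assms(2) show ?thesis by (auto intro: that)
qed

text \<open>With finite orbits only finitely many patterns on \<open>D\<close> occur; one a.e.
  injective map is kept for each. Conditions on all elements thus become conditions on finitely
  many.\<close>

lemma finite_representatives:
  assumes "\<And>\<alpha>. finite (forward_orbit \<alpha> M)" "finite D"
  obtains R where "finite R" "R \<subseteq> M" "\<And>g. g \<in> R \<Longrightarrow> ae_injective g"
    "\<And>g. g \<in> M \<Longrightarrow> ae_injective g \<Longrightarrow> \<exists>g'\<in>R. \<forall>x\<in>D. g' x = g x"
proof -
  let ?A = "{g \<in> M. ae_injective g}"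
  let ?r = "\<lambda>g. restrict g D"
  have "?r ` ?A \<subseteq> Pi\<^sub>E D (\<lambda>\<alpha>. forward_orbit \<alpha> M)" by (auto simp: mem_forward_orbit_iff)
  then have "finite (?r ` ?A)" using assms finite_PiE finite_subset by meson
  then obtain R where R: "R \<subseteq> ?A" "finite R" "?r ` ?A = ?r ` R"
    using finite_subset_image[of "?r ` ?A" ?r ?A] by blast
  have "\<exists>g'\<in>R. \<forall>x\<in>D. g' x = g x" if "g \<in> ?A" for g
  proof -
    from that R(3) obtain g' where "g' \<in> R" "?r g = ?r g'" by blast
    then show ?thesis by (metis restrict_apply')
  qed
  with R show ?thesis by (intro that[of R]) auto
qed

end

text \<open>The \<open>i\<close>-th and all later approximations to a limit agree on the \<open>i\<close>-th history.\<close>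

definition history :: "(nat \<Rightarrow> 'a) \<Rightarrow> (nat \<Rightarrow> 'a) \<Rightarrow> nat \<Rightarrow> 'a set" where
  "history w \<alpha> i = w ` {..<i} \<union> \<alpha> ` {..<i}"

lemma finite_history: "finite (history w \<alpha> i)"
  by (simp add: history_def)

lemma history_mono: "i \<le> j \<Longrightarrow> history w \<alpha> i \<subseteq> history w \<alpha> j"
  by (fastforce simp: history_def)

lemma history_cong: "(\<And>j. j < i \<Longrightarrow> \<alpha> j = \<beta> j) \<Longrightarrow> history w \<alpha> i = history w \<beta> i"
  by (auto simp: history_def)

text \<open>Step \<open>i\<close> replaces the current approximation by one that agrees with it on
  the history and has the prescribed reading at \<open>\<alpha> i\<close>. Since \<open>w\<close>
  lists all points, each value is eventually frozen, and closedness puts the limit into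
  \<open>M\<close>.\<close>

lemma (in closed_monoid) limit_selection:
  fixes w \<alpha> :: "nat \<Rightarrow> 'a" and b :: "'a \<Rightarrow> 'b"
  assumes "bij w"
    and step: "\<And>i g t. g \<in> M \<Longrightarrow> ae_injective g \<Longrightarrow> t \<in> T i \<Longrightarrow>
      \<exists>g'\<in>M. ae_injective g' \<and> (\<forall>x\<in>history w \<alpha> i. g' x = g x) \<and> b (g' (\<alpha> i)) = t"
    and \<phi>: "\<And>i. \<phi> i \<in> T i"
  shows "\<exists>g\<in>M. \<forall>i. b (g (\<alpha> i)) = \<phi> i"
proof -
  have "\<exists>G. \<forall>i. (G i \<in> M \<and> ae_injective (G i)) \<and>
     ((\<forall>x\<in>history w \<alpha> i. G (Suc i) x = G i x) \<and> b (G (Suc i) (\<alpha> i)) = \<phi> i)"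
  proof (rule dependent_nat_choice)
    show "\<exists>x. x \<in> M \<and> ae_injective x" using id_mem ae_injective_id by blast
    fix g i assume "g \<in> M \<and> ae_injective g"
    then show "\<exists>g'. (g' \<in> M \<and> ae_injective g') \<and>
        (\<forall>x\<in>history w \<alpha> i. g' x = g x) \<and> b (g' (\<alpha> i)) = \<phi> i"
      using step[of g "\<phi> i" i] \<phi> by blast
  qed
  then obtain G where G: "\<And>i. G i \<in> M" "\<And>i x. x \<in> history w \<alpha> i \<Longrightarrow> G (Suc i) x = G i x"
     "\<And>i. b (G (Suc i) (\<alpha> i)) = \<phi> i" by blast
  have stable: "G k x = G i x" if "i \<le> k" "x \<in> history w \<alpha> i" for i k x
    using that
  proof (induction k rule: dec_induct)
    case (step n)
    then show ?case using G(2)[of x n] history_mono[of i n w \<alpha>] by auto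
  qed auto
  \<comment> \<open>The point \<open>w k\<close> belongs to the history of stage
    \<open>Suc k\<close>, from which on its value is frozen.\<close>
  define g where "g x = G (Suc (inv_into UNIV w x)) x" for x
  have w: "w (inv_into UNIV w x) = x" for x using assms(1) by (simp add: bij_is_surj surj_f_inv_f)
  have hist: "x \<in> history w \<alpha> (Suc (inv_into UNIV w x))" for x
    using w[of x] by (force simp: history_def)
  have g: "g x = G n x" if "x \<in> history w \<alpha> n" for x n
    using stable[of n "max n (Suc (inv_into UNIV w x))" x] stable[of "Suc (inv_into UNIV w x)" "max n (Suc (inv_into UNIV w x))" x]
      that hist[of x] by (simp add: g_def)
  have "g \<in> M"
  proof (rule closed)
    fix F :: "'a set" assume "finite F"
    then obtain n where "inv_into UNIV w ` F \<subseteq> {..<n}" using finite_nat_iff_bounded by blast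
    then have "Suc (inv_into UNIV w x) \<le> n" if "x \<in> F" for x using that by fastforce
    then have "x \<in> history w \<alpha> n" if "x \<in> F" for x
      using hist[of x] history_mono[of "Suc (inv_into UNIV w x)" n w \<alpha>] that by blast
    then show "\<exists>h\<in>M. \<forall>x\<in>F. h x = g x" using g G(1) by (intro bexI[of _ "G n"] ballI) (metis, blast)
  qed
  \<comment> \<open>Also \<open>\<alpha> i\<close> belongs to the history of stage
    \<open>Suc i\<close>, so the reading arranged in step \<open>i\<close> survives in the
    limit.\<close>
  moreover have "b (g (\<alpha> i)) = \<phi> i" for i
    using g[of "\<alpha> i" "Suc i"] G(3)[of i] by (simp add: history_def)
  ultimately show ?thesis by blast
qed

lemma encode_fin_gen_over:
  fixes w :: "nat \<Rightarrow> 'a"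
  assumes "bij w" "\<And>f. f \<in> K \<Longrightarrow> \<exists>g\<in>M. \<forall>i. b (g (\<alpha> i)) = f (w i)"
  shows "K \<lessapprox> M"
proof (rule fin_gen_over_comp)
  fix f assume "f \<in> K"
  then obtain g where g: "g \<in> M" "\<And>i. b (g (\<alpha> i)) = f (w i)" using assms(2) by blast
  have "f x = (b \<circ> g \<circ> (\<alpha> \<circ> inv_into UNIV w)) x" for x
    using g(2)[of "inv_into UNIV w x"] assms(1) by (simp add: bij_is_surj surj_f_inv_f)
  with g(1) show "\<exists>g\<in>M. f = b \<circ> g \<circ> (\<alpha> \<circ> inv_into UNIV w)" by blast
qed

section \<open>Solving countably many requirements greedily\<close>

text \<open>A pair \<open>(P, t)\<close> is the requirement that some point of \<open>P\<close> be
  sent to \<open>t\<close>. Requirements are met one by one at fresh points; the size bound says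
  that the points already in use never exhaust \<open>P\<close>.\<close>

lemma extend_partial_map:
  fixes Q :: "('a set \<times> 'b) set"
  assumes "finite Q" "finite (dom m)" "card (dom m) \<le> k"
    "\<And>P t. (P, t) \<in> Q \<Longrightarrow> infinite P \<or> k + card Q \<le> card P"
  shows "\<exists>m'. m \<subseteq>\<^sub>m m' \<and> finite (dom m') \<and> card (dom m') \<le> k + card Q \<and>
    (\<forall>(P, t)\<in>Q. \<exists>p\<in>P. m' p = Some t)"
  using assms
proof (induction Q arbitrary: m k rule: finite_induct)
  case empty
  then show ?case by (intro exI[of _ m]) auto
next
  case (insert q Q)
  obtain P t where q: "q = (P, t)" by fastforce
  have "\<not> P \<subseteq> dom m"
  proof
    assume sub: "P \<subseteq> dom m"
    have "finite P" "card P \<le> k"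
      using finite_subset[OF sub insert.prems(1)] card_mono[OF insert.prems(1) sub] insert.prems(2)
      by simp_all
    then show False using insert.prems(3)[of P t] insert.hyps q by auto
  qed
  then obtain p where p: "p \<in> P" "p \<notin> dom m" by blast
  have "\<exists>m'. m(p \<mapsto> t) \<subseteq>\<^sub>m m' \<and> finite (dom m') \<and> card (dom m') \<le> Suc k + card Q \<and>
    (\<forall>(P, t)\<in>Q. \<exists>p\<in>P. m' p = Some t)"
  proof (rule insert.IH)
    show "finite (dom (m(p \<mapsto> t)))" using insert.prems(1) by simp
    show "card (dom (m(p \<mapsto> t))) \<le> Suc k" using insert.prems(1,2) p(2) by (simp add: card_insert_if)
    show "infinite P' \<or> Suc k + card Q \<le> card P'" if "(P', t') \<in> Q" for P' t'
      using insert.prems(3)[of P' t'] insert.hyps that by auto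
  qed
  then obtain m' where m': "m(p \<mapsto> t) \<subseteq>\<^sub>m m'" "finite (dom m')" "card (dom m') \<le> Suc k + card Q"
    "\<forall>(P, t)\<in>Q. \<exists>p\<in>P. m' p = Some t" by blast
  have "m' p = Some t" using m'(1) unfolding map_le_def by (metis domI fun_upd_same)
  moreover have "m \<subseteq>\<^sub>m m'" unfolding map_le_def
  proof
    fix x assume "x \<in> dom m"
    with p(2) have "x \<noteq> p" by blast
    with m'(1) \<open>x \<in> dom m\<close> show "m x = m' x" unfolding map_le_def by force
  qed
  moreover have "card (dom m') \<le> k + card (insert q Q)" using m'(3) insert.hyps by simp
  moreover have "\<forall>(P, t)\<in>insert q Q. \<exists>p\<in>P. m' p = Some t"
    using m'(4) p(1) calculation(1) q by blast
  ultimately show ?case using m'(2) by blast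
qed

text \<open>Requirements arrive in finite batches. One in batch \<open>i\<close> competes only with
  those of batches up to \<open>i\<close>, so its set must be as large as their total
  number.\<close>

lemma greedy_map:
  fixes R :: "nat \<Rightarrow> ('a set \<times> 'b) set"
  assumes "\<And>i. finite (R i)"
    "\<And>i P t. (P, t) \<in> R i \<Longrightarrow> infinite P \<or> (\<Sum>j\<le>i. card (R j)) \<le> card P"
  obtains b where "\<And>i P t. (P, t) \<in> R i \<Longrightarrow> \<exists>p\<in>P. b p = t"
proof -
  define Q where "Q i m m' \<longleftrightarrow> m \<subseteq>\<^sub>m m' \<and> (\<forall>(P, t)\<in>R i. \<exists>p\<in>P. m' p = Some t)" for i m m'
  have "\<exists>m. \<forall>i. (finite (dom (m i)) \<and> card (dom (m i)) \<le> (\<Sum>j<i. card (R j))) \<and> Q i (m i) (m (Suc i))"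
  proof (rule dependent_nat_choice)
    show "\<exists>m :: 'a \<rightharpoonup> 'b. finite (dom m) \<and> card (dom m) \<le> (\<Sum>j<0. card (R j))"
      by (intro exI[of _ Map.empty]) auto
    fix m :: "'a \<rightharpoonup> 'b" and i
    assume m: "finite (dom m) \<and> card (dom m) \<le> (\<Sum>j<i. card (R j))"
    have "\<exists>m'. m \<subseteq>\<^sub>m m' \<and> finite (dom m') \<and> card (dom m') \<le> (\<Sum>j<i. card (R j)) + card (R i) \<and>
        (\<forall>(P, t)\<in>R i. \<exists>p\<in>P. m' p = Some t)"
    proof (rule extend_partial_map)
      show "infinite P \<or> (\<Sum>j<i. card (R j)) + card (R i) \<le> card P" if "(P, t) \<in> R i" for P t
        using assms(2)[OF that] by (simp add: lessThan_Suc_atMost[symmetric])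
    qed (use m assms(1) in auto)
    then show "\<exists>m'. (finite (dom m') \<and> card (dom m') \<le> (\<Sum>j<Suc i. card (R j))) \<and> Q i m m'"
      by (auto simp: Q_def)
  qed
  then obtain m where "\<And>i. Q i (m i) (m (Suc i))" by blast
  then have m: "m i \<subseteq>\<^sub>m m (Suc i)" "(P, t) \<in> R i \<Longrightarrow> \<exists>p\<in>P. m (Suc i) p = Some t" for i P t
    unfolding Q_def by blast+
  have mono: "m i \<subseteq>\<^sub>m m j" if "i \<le> j" for i j
    using that by (induction j rule: dec_induct) (auto intro: map_le_trans m(1))
  \<comment> \<open>This is the union of the chain of partial maps. A point that never enters a
    domain gets an unspecified value, on which no requirement relies.\<close>
  define b where "b p = the (m (LEAST i. p \<in> dom (m i)) p)" for p
  have b: "b p = t" if "m i p = Some t" for i p t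
  proof -
    let ?l = "LEAST i. p \<in> dom (m i)"
    have i: "p \<in> dom (m i)" using that by blast
    have "p \<in> dom (m ?l)" "?l \<le> i" by (rule LeastI[of _ i], rule i) (rule Least_le, rule i)
    with mono[of ?l i] that show ?thesis by (auto simp: b_def map_le_def)
  qed
  show ?thesis by (rule that[of b]) (use m(2) b in blast)
qed

section \<open>Model monoids\<close>

text \<open>Since \<open>\<Gamma>\<close> is fixed pointwise, a value that has reached
  \<open>\<Gamma>\<close> stays put; this allows factoring such maps one point of
  \<open>\<Gamma>\<close> at a time.\<close>

definition collapse :: "'a set \<Rightarrow> ('a \<Rightarrow> 'a) set" where
  "collapse \<Gamma> = {f. (\<forall>x. f x \<in> insert x \<Gamma>) \<and> (\<forall>x\<in>\<Gamma>. f x = x)}"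

text \<open>A monoid satisfies condition \<open>c\<close> only if it is below some member and above every member of \<open>model c\<close>.\<close>

fun model :: "label \<Rightarrow> ('a \<Rightarrow> 'a) set set" where
  "model I = {UNIV}"
| "model II = {Pi UNIV B | B. \<forall>x. finite (B x)}"
| "model III = {Pi UNIV B | B. \<exists>n. \<forall>x. finite (B x) \<and> card (B x) \<le> n}"
| "model IV = {collapse \<Gamma> | \<Gamma>. finite \<Gamma>}"
| "model V = {{id}}"

section \<open>Monoids generating the models\<close>

context closed_monoid
begin

text \<open>The branching set of the tree: the values still available at \<open>a\<close> once those
  of \<open>g\<close> on \<open>D\<close> are fixed.\<close>

definition extensions :: "'a set \<Rightarrow> 'a \<Rightarrow> ('a \<Rightarrow> 'a) \<Rightarrow> 'a set" where
  "extensions D a g = {g' a | g'. g' \<in> M \<and> ae_injective g' \<and> (\<forall>x\<in>D. g' x = g x)}"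

lemma extensions_cong: "(\<And>x. x \<in> D \<Longrightarrow> g x = h x) \<Longrightarrow> extensions D a g = extensions D a h"
  by (auto simp: extensions_def)

text \<open>Applying first a map \<open>h\<close> that fixes \<open>D\<close> and then
  \<open>g\<close> leaves the values on \<open>D\<close> unchanged and sends \<open>a\<close> to
  \<open>g (h a)\<close>. Density supplies an a.e. injective \<open>h\<close>.\<close>

lemma image_orbit_subset_extensions:
  assumes "g \<in> M" "ae_injective g" "finite D"
  shows "g ` forward_orbit a (pw_stabilizer M D) \<subseteq> extensions D a g"
proof safe
  fix y assume "y \<in> forward_orbit a (pw_stabilizer M D)"
  from forward_orbit_ae_injective[OF this assms(3)] obtain h
    where h: "h \<in> M" "ae_injective h" "\<forall>x\<in>D. h x = x" "h a = y" .
  then have "g \<circ> h \<in> M \<and> ae_injective (g \<circ> h) \<and> (\<forall>x\<in>D. (g \<circ> h) x = g x)"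
    using assms comp_mem ae_injective_comp by simp
  then show "g y \<in> extensions D a g" using h(4) unfolding extensions_def
    by (intro CollectI exI[of _ "g \<circ> h"]) auto
qed

text \<open>Removing \<open>C\<close> from the orbit costs at most \<open>card C\<close> points, and
  \<open>g\<close> is injective on the rest.\<close>

lemma card_extensions:
  assumes "g \<in> M" "ae_injective g" "finite D" "inj_on g (UNIV - C)" "finite C"
    and "r + card C \<le> card (forward_orbit a (pw_stabilizer M D))"
  shows "infinite (extensions D a g) \<or> r \<le> card (extensions D a g)"
proof (subst disj_commute, rule disjCI)
  let ?X = "forward_orbit a (pw_stabilizer M D)"
  assume "\<not> infinite (extensions D a g)"
  then have "card (g ` (?X - C)) \<le> card (extensions D a g)"
    using image_orbit_subset_extensions[OF assms(1-3), of a] by (intro card_mono) auto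
  moreover have "card (g ` (?X - C)) = card (?X - C)"
    using assms(4) by (intro card_image) (auto intro: inj_on_subset)
  moreover have "card ?X - card C \<le> card (?X - C)" using assms(5) by (rule diff_card_le_card_Diff)
  ultimately show "r \<le> card (extensions D a g)" using assms(6) by linarith
qed

text \<open>An a.e. injective map has finite preimages of finite sets, so it cannot make an infinite
  orbit finite.\<close>

lemma infinite_extensions:
  assumes "g \<in> M" "ae_injective g" "finite D" "infinite (forward_orbit a (pw_stabilizer M D))"
  shows "infinite (extensions D a g)"
proof
  let ?X = "forward_orbit a (pw_stabilizer M D)"
  assume "finite (extensions D a g)"
  then have "finite (g ` ?X)" using image_orbit_subset_extensions[OF assms(1-3)] finite_subset by blast
  then have "finite (g -` (g ` ?X))" by (rule ae_injective_finite_vimage[OF assms(2)])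
  moreover have "?X \<subseteq> g -` (g ` ?X)" by auto
  ultimately show False using assms(4) finite_subset by blast
qed

text \<open>The decoder \<open>b\<close> must work for every a.e. injective \<open>g\<close>,
  because the approximation present at stage \<open>i\<close> depends on the map being encoded,
  while \<open>b\<close> and \<open>\<alpha>\<close> must not.\<close>

lemma fin_gen_over_if_extensions:
  fixes w \<alpha> :: "nat \<Rightarrow> 'a"
  assumes "bij w"
    and "\<And>i g t. g \<in> M \<Longrightarrow> ae_injective g \<Longrightarrow> t \<in> T i \<Longrightarrow>
      \<exists>p\<in>extensions (history w \<alpha> i) (\<alpha> i) g. b p = t"
    and "\<And>f i. f \<in> K \<Longrightarrow> f (w i) \<in> T i"
  shows "K \<lessapprox> M"
proof (rule encode_fin_gen_over[OF assms(1)])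
  fix f assume f: "f \<in> K"
  show "\<exists>g\<in>M. \<forall>i. b (g (\<alpha> i)) = f (w i)"
  proof (rule limit_selection[OF assms(1)])
    show "f (w i) \<in> T i" for i using assms(3) f by blast
    show "\<exists>g'\<in>M. ae_injective g' \<and> (\<forall>x\<in>history w \<alpha> i. g' x = g x) \<and> b (g' (\<alpha> i)) = t"
      if "g \<in> M" "ae_injective g" "t \<in> T i" for i g t
      using assms(2)[OF that] unfolding extensions_def by blast
  qed
qed

text \<open>A branching set depends only on the values of \<open>g\<close> on a finite history, so
  there are countably many pairs of a branching set and a target. All branching sets are infinite,
  so one \<open>b\<close> can meet all these requirements.\<close>

lemma UNIV_fin_gen_over:
  fixes w :: "nat \<Rightarrow> 'a"
  assumes "bij w" and inf: "\<And>S. finite S \<Longrightarrow> \<exists>\<alpha>. infinite (forward_orbit \<alpha> (pw_stabilizer M S))"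
  shows "UNIV \<lessapprox> M"
proof -
  \<comment> \<open>The condition on \<open>\<alpha> i\<close> involves the earlier points through
    the history, hence the recursive choice with its congruence condition.\<close>
  have "\<exists>\<alpha>. \<forall>i. infinite (forward_orbit (\<alpha> i) (pw_stabilizer M (history w \<alpha> i)))"
  proof (rule dependent_wellorder_choice)
    show "infinite (forward_orbit r (pw_stabilizer M (history w f i))) =
        infinite (forward_orbit r (pw_stabilizer M (history w g i)))"
      if "\<And>j. j < i \<Longrightarrow> f j = g j" for r f g i
      using history_cong[of i f g w] that by simp
  qed (use inf finite_history in blast)
  then obtain \<alpha> where \<alpha>: "infinite (forward_orbit (\<alpha> i) (pw_stabilizer M (history w \<alpha> i)))" for i
    by blast
  let ?D = "history w \<alpha>"
  define R where "R = {(extensions (?D i) (\<alpha> i) g, t :: 'a) | i g t. g \<in> M \<and> ae_injective g}"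
  let ?S = "\<lambda>i. Pi\<^sub>E (?D i) (\<lambda>_. UNIV) \<times> UNIV :: (('a \<Rightarrow> 'a) \<times> 'a) set"
  have "countable (UNIV :: 'a set)"
    using assms(1) by (metis bij_is_surj countable_image countableI_type)
  then have "countable (?S i)" for i
    by (intro countable_SIGMA countable_PiE) (auto simp: finite_history)
  then have "countable (\<Union>i. (\<lambda>(g, t). (extensions (?D i) (\<alpha> i) g, t)) ` ?S i)"
    by (intro countable_UN countable_image) auto
  moreover have "R \<subseteq> (\<Union>i. (\<lambda>(g, t). (extensions (?D i) (\<alpha> i) g, t)) ` ?S i)"
  proof
    fix r assume "r \<in> R"
    then obtain i g t where r: "r = (extensions (?D i) (\<alpha> i) g, t)" unfolding R_def by blast
    have "extensions (?D i) (\<alpha> i) g = extensions (?D i) (\<alpha> i) (restrict g (?D i))"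
      by (rule extensions_cong) simp
    then show "r \<in> (\<Union>i. (\<lambda>(g, t). (extensions (?D i) (\<alpha> i) g, t)) ` ?S i)"
      unfolding r by (intro UN_I[of i] image_eqI[of _ _ "(restrict g (?D i), t)"]) auto
  qed
  ultimately have count: "countable R" by (rule countable_subset[rotated])
  have "R \<noteq> {}" using id_mem ae_injective_id by (auto simp: R_def)
  then have range: "range (from_nat_into R) = R" using count by (rule range_from_nat_into)
  obtain b where b: "\<And>i P t. (P, t) \<in> {from_nat_into R i} \<Longrightarrow> \<exists>p\<in>P. b p = t"
  proof (rule greedy_map[of "\<lambda>i. {from_nat_into R i}"])
    show "infinite P \<or> (\<Sum>j\<le>i. card {from_nat_into R j}) \<le> card P"
      if "(P, t) \<in> {from_nat_into R i}" for i P t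
    proof -
      have "(P, t) \<in> R" using that range rangeI[of "from_nat_into R" i] by simp
      then obtain j g where "P = extensions (?D j) (\<alpha> j) g" "g \<in> M" "ae_injective g"
        unfolding R_def by blast
      then have "infinite P" using infinite_extensions[OF _ _ finite_history \<alpha>] by blast
      then show ?thesis ..
    qed
  qed auto
  have b': "\<exists>p\<in>P. b p = t" if Pt: "(P, t) \<in> R" for P t
  proof -
    from Pt range obtain i where "(P, t) = from_nat_into R i" by (metis imageE)
    with b[of P t i] show ?thesis by simp
  qed
  show ?thesis
  proof (rule fin_gen_over_if_extensions[OF assms(1)])
    fix i g t assume "g \<in> M" "ae_injective g"
    then show "\<exists>p\<in>extensions (?D i) (\<alpha> i) g. b p = t" by (intro b') (auto simp: R_def)
  qed auto
qed

text \<open>Each stage has finitely many requirements, one for every representative on the history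
  and every target in \<open>B (w i)\<close>. As orbits are unbounded, \<open>\<alpha> i\<close> can
  be chosen with branching sets exceeding the number of requirements so far.\<close>

lemma finite_choices_fin_gen_over:
  fixes w :: "nat \<Rightarrow> 'a"
  assumes "bij w" and fin: "\<And>\<alpha>. finite (forward_orbit \<alpha> M)"
    and unbounded: "\<And>S n. finite S \<Longrightarrow> \<not> orbits_bounded (pw_stabilizer M S) n"
    and B: "\<And>x. finite (B x)"
  shows "Pi UNIV B \<lessapprox> M"
proof -
  have "\<exists>R. finite R \<and> R \<subseteq> M \<and> (\<forall>g\<in>R. ae_injective g) \<and>
      (\<forall>g\<in>M. ae_injective g \<longrightarrow> (\<exists>g'\<in>R. \<forall>x\<in>D. g' x = g x))" if "finite D" for D
    using finite_representatives[OF fin that] by metis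
  then obtain R where R: "\<And>D. finite D \<Longrightarrow> finite (R D) \<and> R D \<subseteq> M \<and> (\<forall>g\<in>R D. ae_injective g) \<and>
      (\<forall>g\<in>M. ae_injective g \<longrightarrow> (\<exists>g'\<in>R D. \<forall>x\<in>D. g' x = g x))" by metis
  \<comment> \<open>A bound for the number of requirements up to stage \<open>i\<close> inclusive.
    It involves only \<open>\<alpha> j\<close> with \<open>j < i\<close>, so it is known when
    \<open>\<alpha> i\<close> is chosen.\<close>
  define r where "r \<alpha> i = (\<Sum>j\<le>i. card (R (history w \<alpha> j)) * card (B (w j)))" for \<alpha> i
  let ?P = "\<lambda>\<alpha> i a. \<forall>g\<in>R (history w \<alpha> i). infinite (extensions (history w \<alpha> i) a g) \<or>
      r \<alpha> i \<le> card (extensions (history w \<alpha> i) a g)"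
  have "\<exists>\<alpha>. \<forall>i. ?P \<alpha> i (\<alpha> i)"
  proof (rule dependent_wellorder_choice)
    fix a :: 'a and f g :: "nat \<Rightarrow> 'a" and i :: nat
    assume fg: "\<And>j. j < i \<Longrightarrow> f j = g j"
    have "history w f j = history w g j" if "j \<le> i" for j
      by (rule history_cong) (use fg that in auto)
    then have "r f i = r g i" "history w f i = history w g i" unfolding r_def by (auto intro: sum.cong)
    then show "?P f i a = ?P g i a" by simp
  next
    fix i :: nat and \<alpha> :: "nat \<Rightarrow> 'a"
    let ?D = "history w \<alpha> i"
    note RD = R[OF finite_history[of w \<alpha> i]]
    obtain C where C: "finite C" "\<forall>g\<in>R ?D. inj_on g (UNIV - C)"
      using ae_injective_family[of "R ?D"] RD by blast
    have "\<not> orbits_bounded (pw_stabilizer M ?D) (r \<alpha> i + card C)"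
      by (rule unbounded[OF finite_history])
    moreover have "finite (forward_orbit a (pw_stabilizer M ?D))" for a
      using fin forward_orbit_mono[OF pw_stabilizer_subset] by (rule finite_subset[rotated])
    ultimately obtain a where "r \<alpha> i + card C \<le> card (forward_orbit a (pw_stabilizer M ?D))"
      unfolding orbits_bounded_def by (metis nat_le_linear)
    then have "?P \<alpha> i a"
      using RD C finite_history by (intro ballI card_extensions) auto
    then show "\<exists>a. ?P \<alpha> i a" ..
  qed
  then obtain \<alpha> where \<alpha>: "\<And>i. ?P \<alpha> i (\<alpha> i)" by blast
  let ?D = "history w \<alpha>"
  let ?Q = "\<lambda>i. (\<lambda>(g, t). (extensions (?D i) (\<alpha> i) g, t)) ` (R (?D i) \<times> B (w i))"
  have finQ: "finite (R (?D i) \<times> B (w i))" for i using R[OF finite_history] B by simp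
  obtain b where b: "\<And>i P t. (P, t) \<in> ?Q i \<Longrightarrow> \<exists>p\<in>P. b p = t"
  proof (rule greedy_map[of ?Q])
    show "infinite P \<or> (\<Sum>j\<le>i. card (?Q j)) \<le> card P" if "(P, t) \<in> ?Q i" for i P t
    proof -
      have "card (?Q j) \<le> card (R (?D j)) * card (B (w j))" for j
        using card_image_le[OF finQ] by (simp add: card_cartesian_product)
      then have "(\<Sum>j\<le>i. card (?Q j)) \<le> r \<alpha> i" unfolding r_def by (intro sum_mono)
      moreover have "infinite P \<or> r \<alpha> i \<le> card P" using that \<alpha>[of i] by auto
      ultimately show ?thesis by linarith
    qed
  qed (use finQ in auto)
  show ?thesis
  proof (rule fin_gen_over_if_extensions[OF assms(1)])
    fix i g t assume g: "g \<in> M" "ae_injective g" and t: "t \<in> B (w i)"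
    obtain g' where g': "g' \<in> R (?D i)" "\<forall>x\<in>?D i. g' x = g x" using R[OF finite_history] g by blast
    have "extensions (?D i) (\<alpha> i) g' = extensions (?D i) (\<alpha> i) g" by (rule extensions_cong) (use g' in blast)
    moreover have "(extensions (?D i) (\<alpha> i) g', t) \<in> ?Q i" using g'(1) t by force
    ultimately show "\<exists>p\<in>extensions (?D i) (\<alpha> i) g. b p = t" using b[of _ t i] by metis
  qed auto
qed

end

text \<open>
  Let \<open>m\<close> be maximal such that even after shrinking the monoid to a pointwise stabilizer and deleting a
  finite set there are orbits of size \<open>m\<close>. Beyond some finite set, orbits of size \<open>m\<close> cannot shrink any
  further, so an element that is injective on such an orbit permutes it: the choices available at the
  next point do not depend on the choices made before.
\<close>

lemma (in closed_monoid) binary_choices_fin_gen_over: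
  fixes w :: "nat \<Rightarrow> 'a"
  assumes "bij w" and bounded: "orbits_bounded M n"
    and escape: "\<And>\<Gamma> \<Delta>. finite \<Gamma> \<Longrightarrow> finite \<Delta> \<Longrightarrow>
      \<exists>\<alpha>. \<not> forward_orbit \<alpha> (pw_stabilizer M \<Delta>) \<subseteq> \<Gamma> \<union> {\<alpha>}"
  shows "{f. \<forall>i. f (w i) \<in> {w (2 * i), w (2 * i + 1)}} \<lessapprox> M"
proof -
  let ?Q = "\<lambda>m. \<forall>\<Gamma> \<Delta>. finite \<Gamma> \<longrightarrow> finite \<Delta> \<longrightarrow>
    (\<exists>\<alpha>. m \<le> card (forward_orbit \<alpha> (pw_stabilizer M \<Delta>) - \<Gamma>))"
  have finM: "finite (forward_orbit \<alpha> M)" "card (forward_orbit \<alpha> M) \<le> n" for \<alpha>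
    using bounded by (auto simp: orbits_bounded_def)
  have fin: "finite (forward_orbit \<alpha> (pw_stabilizer M \<Delta>))" for \<alpha> \<Delta>
    using finM(1) forward_orbit_mono[OF pw_stabilizer_subset] by (rule finite_subset[rotated])
  \<comment> \<open>Stabilizing \<open>\<Gamma>\<close> as well forces a point with an image outside
    \<open>\<Gamma>\<close> to lie outside \<open>\<Gamma>\<close> itself; the point and its image
    then give size 2.\<close>
  have Q2: "?Q 2"
  proof (intro allI impI)
    fix \<Gamma> \<Delta> :: "'a set" assume "finite \<Gamma>" "finite \<Delta>"
    then obtain \<alpha> where \<alpha>: "\<not> forward_orbit \<alpha> (pw_stabilizer M (\<Delta> \<union> \<Gamma>)) \<subseteq> \<Gamma> \<union> {\<alpha>}"
      using escape[of \<Gamma> "\<Delta> \<union> \<Gamma>"] by auto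
    then obtain \<beta> where \<beta>: "\<beta> \<in> forward_orbit \<alpha> (pw_stabilizer M (\<Delta> \<union> \<Gamma>))" "\<beta> \<notin> \<Gamma>" "\<beta> \<noteq> \<alpha>" by blast
    then have "\<alpha> \<notin> \<Gamma>" by (auto simp: mem_forward_orbit_iff pw_stabilizer_def)
    moreover have "\<alpha> \<in> forward_orbit \<alpha> (pw_stabilizer M \<Delta>)"
      using id_mem by (auto simp: mem_forward_orbit_iff pw_stabilizer_def intro!: bexI[of _ id])
    moreover have "\<beta> \<in> forward_orbit \<alpha> (pw_stabilizer M \<Delta>)"
      using \<beta>(1) forward_orbit_mono[OF pw_stabilizer_antimono[of \<Delta> "\<Delta> \<union> \<Gamma>"]] by blast
    ultimately have "{\<alpha>, \<beta>} \<subseteq> forward_orbit \<alpha> (pw_stabilizer M \<Delta>) - \<Gamma>" using \<beta> by blast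
    then have "card {\<alpha>, \<beta>} \<le> card (forward_orbit \<alpha> (pw_stabilizer M \<Delta>) - \<Gamma>)"
      by (rule card_mono[rotated]) (use fin in auto)
    moreover have "card {\<alpha>, \<beta>} = 2" using \<beta>(3) by simp
    ultimately show "\<exists>\<alpha>. 2 \<le> card (forward_orbit \<alpha> (pw_stabilizer M \<Delta>) - \<Gamma>)" by metis
  qed
  have Qn: "m \<le> n" if "?Q m" for m
  proof -
    have "\<exists>\<alpha>. m \<le> card (forward_orbit \<alpha> (pw_stabilizer M {}) - {})"
      using that by (meson finite.emptyI)
    then obtain \<alpha> where "m \<le> card (forward_orbit \<alpha> (pw_stabilizer M {}) - {})" ..
    then show ?thesis using finM(2)[of \<alpha>] by (simp add: pw_stabilizer_def)
  qed
  obtain m where Qm: "?Q m" and max: "\<And>k. ?Q k \<Longrightarrow> k \<le> m"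
    using ex_has_greatest_nat[of ?Q 2 "\<lambda>x. x" "Suc n"] Q2 Qn by (metis less_Suc_eq_le)
  have m2: "2 \<le> m" by (rule max[OF Q2])
  \<comment> \<open>Maximality yields a stabilizer \<open>N\<close> and a finite
    \<open>\<Gamma>\<close> outside of which no orbit has more than \<open>m\<close> points.\<close>
  have "\<not> ?Q (Suc m)" using max[of "Suc m"] by auto
  then obtain \<Gamma> \<Delta> where fin_GD: "finite \<Gamma>" "finite \<Delta>"
    and small: "\<And>\<alpha>. \<not> Suc m \<le> card (forward_orbit \<alpha> (pw_stabilizer M \<Delta>) - \<Gamma>)" by blast
  define N where "N = pw_stabilizer M \<Delta>"
  interpret N: closed_monoid N unfolding N_def by (rule closed_monoid_pw_stabilizer[OF fin_GD(2)])
  define orb where "orb \<alpha> = forward_orbit \<alpha> N - \<Gamma>" for \<alpha>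
  have fin_orb: "finite (orb \<alpha>)" and card_orb: "card (orb \<alpha>) \<le> m" for \<alpha>
    using fin small[of \<alpha>] unfolding orb_def N_def by auto
  let ?P = "\<lambda>\<alpha> i a. 2 \<le> card (orb a) \<and> (\<forall>j<i. orb a \<inter> orb (\<alpha> j) = {}) \<and>
    (\<forall>g\<in>N. ae_injective g \<longrightarrow> orb a \<subseteq> N.extensions (history w \<alpha> i) a g)"
  have "\<exists>\<alpha>. \<forall>i. ?P \<alpha> i (\<alpha> i)"
  proof (rule dependent_wellorder_choice)
    fix a :: 'a and f g :: "nat \<Rightarrow> 'a" and i :: nat
    assume fg: "\<And>j. j < i \<Longrightarrow> f j = g j"
    then show "?P f i a = ?P g i a" using history_cong[of i f g w] by auto
  next
    fix i :: nat and \<alpha> :: "nat \<Rightarrow> 'a"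
    let ?D = "history w \<alpha> i"
    obtain R where R: "finite R" "R \<subseteq> N" "\<And>g. g \<in> R \<Longrightarrow> ae_injective g"
      "\<And>g. g \<in> N \<Longrightarrow> ae_injective g \<Longrightarrow> \<exists>g'\<in>R. \<forall>x\<in>?D. g' x = g x"
      using N.finite_representatives[of ?D] fin finite_history unfolding N_def by metis
    obtain C where C: "finite C" "\<forall>g\<in>R. inj_on g (UNIV - C)"
      using ae_injective_family[OF R(1,3)] by blast
    \<comment> \<open>Deleted are the exceptional points of the representatives, the points they
      send into \<open>\<Gamma>\<close>, and the parts \<open>orb (\<alpha> j)\<close> in
      use.\<close>
    let ?G = "\<Gamma> \<union> C \<union> (\<Union>g\<in>R. g -` \<Gamma>) \<union> (\<Union>j<i. orb (\<alpha> j))"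
    have "finite ?G" using fin_GD C(1) R(1,3) fin_orb by (auto intro!: ae_injective_finite_vimage)
    then obtain a where a: "m \<le> card (forward_orbit a (pw_stabilizer M (\<Delta> \<union> ?D)) - ?G)"
      using Qm fin_GD finite_history by (meson finite_UnI)
    let ?X = "forward_orbit a (pw_stabilizer M (\<Delta> \<union> ?D)) - ?G"
    \<comment> \<open>Still \<open>m\<close> points remain, which is all that \<open>orb a\<close>
      can have; so \<open>orb a\<close> avoids everything deleted.\<close>
    have X: "?X = orb a"
    proof (rule card_seteq[OF fin_orb])
      show "?X \<subseteq> orb a"
        using forward_orbit_mono[OF pw_stabilizer_antimono[of \<Delta> "\<Delta> \<union> ?D"]] unfolding orb_def N_def by blast
      show "card (orb a) \<le> card ?X" using a card_orb[of a] by linarith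
    qed
    have "orb a \<subseteq> N.extensions ?D a g" if g: "g \<in> N" "ae_injective g" for g
    proof -
      obtain g' where g': "g' \<in> R" "\<forall>x\<in>?D. g' x = g x" using R(4)[OF g] by blast
      have "g' ` orb a \<subseteq> orb a"
      proof safe
        fix y assume y: "y \<in> orb a"
        then obtain h where h: "h \<in> N" "h a = y" by (auto simp: orb_def mem_forward_orbit_iff)
        have "g' \<circ> h \<in> N" using N.comp_mem h g' R(2) by blast
        then have "g' y \<in> forward_orbit a N" using h(2) by (auto simp: mem_forward_orbit_iff intro!: bexI[of _ "g' \<circ> h"])
        moreover have "g' y \<notin> \<Gamma>" using y X g'(1) by blast
        ultimately show "g' y \<in> orb a" by (simp add: orb_def)
      qed
      moreover have "inj_on g' (orb a)" using C(2) g'(1) X by (auto intro: inj_on_subset)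
      ultimately have "g' ` orb a = orb a" using fin_orb by (intro endo_inj_surj)
      moreover have "orb a \<subseteq> forward_orbit a (pw_stabilizer N ?D)"
        using X unfolding N_def pw_stabilizer_pw_stabilizer by blast
      moreover have "g' ` forward_orbit a (pw_stabilizer N ?D) \<subseteq> N.extensions ?D a g'"
        by (rule N.image_orbit_subset_extensions) (use g' R finite_history in auto)
      moreover have "N.extensions ?D a g' = N.extensions ?D a g"
        by (rule N.extensions_cong) (use g'(2) in blast)
      ultimately show ?thesis by blast
    qed
    moreover have "2 \<le> card (orb a)" using a X m2 by simp
    moreover have "orb a \<inter> orb (\<alpha> j) = {}" if "j < i" for j using X that by blast
    ultimately show "\<exists>a. ?P \<alpha> i a" by blast
  qed
  then obtain \<alpha> where \<alpha>: "\<And>i. ?P \<alpha> i (\<alpha> i)" by blast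
  have "\<exists>p q. p \<in> orb (\<alpha> i) \<and> q \<in> orb (\<alpha> i) \<and> p \<noteq> q" for i
    using \<alpha>[of i] fin_orb[of "\<alpha> i"] by (metis card_le_Suc0_iff_eq not_less_eq_eq numeral_2_eq_2)
  then obtain p q where pq: "\<And>i. p i \<in> orb (\<alpha> i)" "\<And>i. q i \<in> orb (\<alpha> i)" "\<And>i. p i \<noteq> q i" by metis
  define index where "index y = (THE i. y \<in> orb (\<alpha> i))" for y
  have index: "index y = i" if "y \<in> orb (\<alpha> i)" for y i
    unfolding index_def
  proof (rule the_equality[where P = "\<lambda>i. y \<in> orb (\<alpha> i)", OF that])
    fix j assume "y \<in> orb (\<alpha> j)"
    with that \<alpha>[of i] \<alpha>[of j] show "j = i" by (metis disjoint_iff linorder_neqE_nat)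
  qed
  \<comment> \<open>Disjointness of the sets \<open>orb (\<alpha> i)\<close> lets \<open>b\<close>
    recover the stage from the point; \<open>p i\<close> encodes one binary choice and every other
    point of \<open>orb (\<alpha> i)\<close> the other.\<close>
  define b where "b y = (if y = p (index y) then w (2 * index y) else w (2 * index y + 1))" for y
  have "{f. \<forall>i. f (w i) \<in> {w (2 * i), w (2 * i + 1)}} \<lessapprox> N"
  proof (rule N.fin_gen_over_if_extensions[OF assms(1)])
    fix i g t assume g: "g \<in> N" "ae_injective g" and "t \<in> {w (2 * i), w (2 * i + 1)}"
    moreover have "b (p i) = w (2 * i)" "b (q i) = w (2 * i + 1)"
      using index[OF pq(1)[of i]] index[OF pq(2)[of i]] pq(3)[of i] by (auto simp: b_def)
    ultimately obtain y where "y \<in> orb (\<alpha> i)" "b y = t" using pq by blast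
    with \<alpha>[of i] g show "\<exists>p\<in>N.extensions (history w \<alpha> i) (\<alpha> i) g. b p = t" by blast
  qed auto
  also have "N \<lessapprox> M" unfolding N_def by (intro fin_gen_over_subset pw_stabilizer_subset)
  finally show ?thesis .
qed

text \<open>Some \<open>\<gamma>\<close> in \<open>\<Gamma>\<close> is hit from outside every finite
  \<open>D\<close> by elements fixing \<open>D\<close>; otherwise a finite union of counterexamples
  would have trivial stabilizer. The choice at \<open>\<alpha> i\<close> is between staying, decoded
  as \<open>w i\<close>, and moving to \<open>\<gamma>\<close>, decoded as
  \<open>\<delta>\<close>.\<close>

lemma (in closed_monoid) collapse_singleton_fin_gen_over:
  fixes w :: "nat \<Rightarrow> 'a"
  assumes "bij w" "finite \<Gamma>"
    and fixed: "\<And>f x. f \<in> M \<Longrightarrow> x \<in> \<Gamma> \<Longrightarrow> f x = x"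
    and orbit: "\<And>\<alpha>. forward_orbit \<alpha> M \<subseteq> \<Gamma> \<union> {\<alpha>}"
    and nontrivial: "\<And>S. finite S \<Longrightarrow> pw_stabilizer M S \<noteq> {id}"
  shows "collapse {\<delta>} \<lessapprox> M"
proof -
  have "\<exists>\<gamma>\<in>\<Gamma>. \<forall>D. finite D \<longrightarrow> (\<exists>a. a \<notin> D \<and> \<gamma> \<in> forward_orbit a (pw_stabilizer M D))"
  proof (rule ccontr)
    assume "\<not> ?thesis"
    then obtain D where D: "\<And>\<gamma>. \<gamma> \<in> \<Gamma> \<Longrightarrow> finite (D \<gamma>)"
      "\<And>\<gamma> a. \<gamma> \<in> \<Gamma> \<Longrightarrow> a \<notin> D \<gamma> \<Longrightarrow> \<gamma> \<notin> forward_orbit a (pw_stabilizer M (D \<gamma>))" by metis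
    let ?E = "\<Union>\<gamma>\<in>\<Gamma>. D \<gamma>"
    have "id \<in> pw_stabilizer M ?E" using id_mem by (simp add: pw_stabilizer_def)
    moreover have "pw_stabilizer M ?E \<noteq> {id}" using nontrivial D(1) assms(2) by blast
    ultimately obtain h where h: "h \<in> pw_stabilizer M ?E" "h \<noteq> id" by blast
    then obtain a where a: "h a \<noteq> a" by (auto simp: fun_eq_iff)
    then have "h a \<in> \<Gamma>" using orbit[of a] h(1) by (auto simp: pw_stabilizer_def forward_orbit_def)
    moreover have "a \<notin> ?E" using a h(1) by (auto simp: pw_stabilizer_def)
    moreover have "h a \<in> forward_orbit a (pw_stabilizer M (D (h a)))"
      using h(1) calculation(1) pw_stabilizer_antimono[of "D (h a)" ?E] by (auto simp: mem_forward_orbit_iff)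
    ultimately show False using D(2)[of "h a" a] by blast
  qed
  then obtain \<gamma> where \<gamma>: "\<gamma> \<in> \<Gamma>"
    "\<And>D. finite D \<Longrightarrow> \<exists>a. a \<notin> D \<and> \<gamma> \<in> forward_orbit a (pw_stabilizer M D)" by blast
  let ?P = "\<lambda>\<alpha> i a. a \<noteq> \<gamma> \<and> a \<notin> \<alpha> ` {..<i} \<and>
    (\<forall>g\<in>M. ae_injective g \<longrightarrow> {a, \<gamma>} \<subseteq> extensions (history w \<alpha> i) a g)"
  have "\<exists>\<alpha>. \<forall>i. ?P \<alpha> i (\<alpha> i)"
  proof (rule dependent_wellorder_choice)
    fix a :: 'a and f g :: "nat \<Rightarrow> 'a" and i :: nat
    assume fg: "\<And>j. j < i \<Longrightarrow> f j = g j"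
    then have "f ` {..<i} = g ` {..<i}" by auto
    then show "?P f i a = ?P g i a" using history_cong[of i f g w] fg by auto
  next
    fix i :: nat and \<alpha> :: "nat \<Rightarrow> 'a"
    let ?D = "history w \<alpha> i"
    have "finite (forward_orbit a M)" for a using finite_subset[OF orbit[of a]] assms(2) by simp
    then obtain R where R: "finite R" "R \<subseteq> M" "\<And>g. g \<in> R \<Longrightarrow> ae_injective g"
      "\<And>g. g \<in> M \<Longrightarrow> ae_injective g \<Longrightarrow> \<exists>g'\<in>R. \<forall>x\<in>?D. g' x = g x"
      using finite_representatives[OF _ finite_history[of w \<alpha> i]] by metis
    \<comment> \<open>No representative sends a point outside \<open>?E\<close> into
      \<open>\<Gamma>\<close>, so by the orbit condition each fixes such a point.\<close>
    let ?E = "?D \<union> \<Gamma> \<union> (\<Union>g\<in>R. g -` \<Gamma>)"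
    have "finite ?E" using finite_history[of w \<alpha> i] assms(2) R(1,3)
      by (auto intro!: ae_injective_finite_vimage)
    from \<gamma>(2)[OF this] obtain a where a: "a \<notin> ?E" "\<gamma> \<in> forward_orbit a (pw_stabilizer M ?E)" by blast
    have \<gamma>D: "\<gamma> \<in> forward_orbit a (pw_stabilizer M ?D)"
      using a(2) forward_orbit_mono[OF pw_stabilizer_antimono[of ?D ?E]] by blast
    have "{a, \<gamma>} \<subseteq> extensions ?D a g" if g: "g \<in> M" "ae_injective g" for g
    proof -
      obtain g' where g': "g' \<in> R" "\<forall>x\<in>?D. g' x = g x" using R(4)[OF g] by blast
      have "g' a \<in> forward_orbit a M" using g'(1) R(2) by (auto simp: mem_forward_orbit_iff)
      then have "g' a = a" using orbit[of a] a(1) g'(1) by blast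
      moreover have "g' \<gamma> = \<gamma>" using fixed \<gamma>(1) g'(1) R(2) by blast
      moreover have "a \<in> forward_orbit a (pw_stabilizer M ?D)"
        using id_mem by (auto simp: mem_forward_orbit_iff pw_stabilizer_def intro!: bexI[of _ id])
      moreover have "g' ` forward_orbit a (pw_stabilizer M ?D) \<subseteq> extensions ?D a g'"
        by (rule image_orbit_subset_extensions) (use g' R finite_history in auto)
      moreover have "extensions ?D a g' = extensions ?D a g"
        by (rule extensions_cong) (use g'(2) in blast)
      ultimately show ?thesis using \<gamma>D by (metis empty_subsetI image_eqI insert_subset subsetD)
    qed
    moreover have "a \<noteq> \<gamma>" "a \<notin> \<alpha> ` {..<i}" using a(1) \<gamma>(1) by (auto simp: history_def)
    ultimately show "\<exists>a. ?P \<alpha> i a" by blast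
  qed
  then obtain \<alpha> where \<alpha>: "\<And>i. ?P \<alpha> i (\<alpha> i)" by blast
  have inj: "inj \<alpha>"
  proof (rule linorder_injI)
    show "\<alpha> i \<noteq> \<alpha> j" if "i < j" for i j
    proof -
      have "\<alpha> j \<notin> \<alpha> ` {..<j}" using \<alpha>[of j] by blast
      moreover have "\<alpha> i \<in> \<alpha> ` {..<j}" using that by simp
      ultimately show ?thesis by metis
    qed
  qed
  define b where "b y = (if y = \<gamma> then \<delta> else w (inv_into UNIV \<alpha> y))" for y
  have b: "b (\<alpha> i) = w i" "b \<gamma> = \<delta>" for i using \<alpha>[of i] inj by (auto simp: b_def)
  show ?thesis
  proof (rule fin_gen_over_if_extensions[OF assms(1)])
    fix i g t assume "g \<in> M" "ae_injective g" and t: "t \<in> {w i, \<delta>}"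
    then have "{\<alpha> i, \<gamma>} \<subseteq> extensions (history w \<alpha> i) (\<alpha> i) g" using \<alpha>[of i] by blast
    then show "\<exists>p\<in>extensions (history w \<alpha> i) (\<alpha> i) g. b p = t" using t b by auto
  qed (auto simp: collapse_def)
qed

section \<open>Building larger models from binary choices and from collapses to one point\<close>

lemma two_halves:
  assumes "finite X" "X \<noteq> {}" "card X \<le> 2 * m" "0 < m"
  shows "\<exists>A B. X = A \<union> B \<and> A \<noteq> {} \<and> B \<noteq> {} \<and> card A \<le> m \<and> card B \<le> m"
proof (cases "card X \<le> m")
  case True
  \<comment> \<open>The halves may overlap: a small set is taken twice, which keeps both of them
    non-empty.\<close>
  then show ?thesis using assms by blast
next
  case False
  then have "m \<le> card X" by simp
  then obtain A where A: "A \<subseteq> X" "card A = m" "finite A" by (rule obtain_subset_with_card_n)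
  then have "card (X - A) = card X - m" by (simp add: card_Diff_subset)
  with A False assms(3,4) show ?thesis
    by (intro exI[of _ A] exI[of _ "X - A"]) auto
qed

text \<open>One binary digit at a time: a binary map \<open>s\<close> records at each point which
  half of \<open>B x\<close> contains the value, and the induction hypothesis handles the choice
  within that half.\<close>

lemma bounded_choices_fin_gen_over_binary:
  fixes w :: "nat \<Rightarrow> 'a" and B :: "'a \<Rightarrow> 'a set"
  assumes "bij w" and "\<And>x. finite (B x) \<and> B x \<noteq> {} \<and> card (B x) \<le> 2 ^ k"
  shows "Pi UNIV B \<lessapprox> {f. \<forall>i. f (w i) \<in> {w (2 * i), w (2 * i + 1)}}"
  using assms(2)
proof (induction k arbitrary: B)
  case 0
  have "\<exists>y. B x = {y}" for x
  proof -
    have "card (B x) \<noteq> 0" "card (B x) \<le> 1" using 0[of x] by auto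
    then have "card (B x) = Suc 0" by linarith
    then show ?thesis by (simp add: card_1_singleton_iff)
  qed
  then obtain y where "\<And>x. B x = {y x}" by metis
  then have "Pi UNIV B = {y}" by (auto simp: Pi_iff fun_eq_iff)
  then show ?case by (simp add: fin_gen_over_finite)
next
  case (Suc k)
  let ?S = "{f. \<forall>i. f (w i) \<in> {w (2 * i), w (2 * i + 1)}}"
  define j where "j = inv_into UNIV w"
  have j: "w (j x) = x" "j (w i) = i" for x i
    using assms(1) by (simp_all add: j_def bij_is_surj surj_f_inv_f bij_is_inj)
  have "\<exists>A C. B x = A \<union> C \<and> A \<noteq> {} \<and> C \<noteq> {} \<and> card A \<le> 2 ^ k \<and> card C \<le> 2 ^ k" for x
    using two_halves[of "B x" "2 ^ k"] Suc.prems[of x] by simp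
  then obtain A C where AC: "\<And>x. B x = A x \<union> C x \<and> A x \<noteq> {} \<and> C x \<noteq> {} \<and>
    card (A x) \<le> 2 ^ k \<and> card (C x) \<le> 2 ^ k" by metis
  \<comment> \<open>The points \<open>w (2 * i)\<close> and \<open>w (2 * i + 1)\<close> stand for
    the first and second half of \<open>B (w i)\<close>.\<close>
  define B' where "B' x = (if even (j x) then A (w (j x div 2)) else C (w (j x div 2)))" for x
  have "Pi UNIV B' \<lessapprox> ?S"
  proof (rule Suc.IH)
    show "finite (B' x) \<and> B' x \<noteq> {} \<and> card (B' x) \<le> 2 ^ k" for x
      using AC[of "w (j x div 2)"] Suc.prems[of "w (j x div 2)"] by (auto simp: B'_def)
  qed
  then obtain U where U: "finite U" "Pi UNIV B' \<subseteq> generated_submonoid (?S \<union> U)"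
    unfolding fin_gen_over_def by blast
  have "f \<in> generated_submonoid (?S \<union> U)" if "f \<in> Pi UNIV B" for f
  proof -
    define s where "s x = (if f x \<in> A x then w (2 * j x) else w (2 * j x + 1))" for x
    \<comment> \<open>At the code of the half that does not contain the value, which
      \<open>s\<close> never produces, any element of that half will do.\<close>
    define f' where "f' x = (let y = f (w (j x div 2)) in if y \<in> B' x then y else SOME z. z \<in> B' x)" for x
    have "B' x \<noteq> {}" for x using AC by (simp add: B'_def)
    then have "f' \<in> Pi UNIV B'" by (auto simp: f'_def Let_def some_in_eq)
    moreover have "s \<in> ?S" by (simp add: s_def j)
    moreover have "f = f' \<circ> s"
    proof
      fix x
      have "f x \<in> A x \<union> C x" using that AC[of x] by (auto simp: Pi_iff)
      then show "f x = (f' \<circ> s) x" by (auto simp: f'_def s_def B'_def j)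
    qed
    ultimately show ?thesis
      using U(2) generated_submonoid_incl[of "?S \<union> U"] by (auto intro!: generated_submonoid_closed(2))
  qed
  with U(1) show ?case unfolding fin_gen_over_def by blast
qed

text \<open>A map is factored into \<open>f1\<close>, which moves exactly what has to go to
  \<open>\<gamma>\<close>, followed by \<open>f2\<close>, which makes the remaining moves into
  \<open>\<Gamma>\<close>.\<close>

lemma collapse_fin_gen_over:
  fixes M :: "('a \<Rightarrow> 'a) set"
  assumes "finite \<Gamma>" "\<And>\<delta>. collapse {\<delta>} \<lessapprox> M"
  shows "collapse \<Gamma> \<lessapprox> M"
  using assms(1)
proof (induction \<Gamma> rule: finite_induct)
  case empty
  have "collapse ({} :: 'a set) = {id}" by (auto simp: collapse_def)
  then show ?case by (simp add: fin_gen_over_finite)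
next
  case (insert \<gamma> \<Gamma>)
  obtain U where U: "finite U" "collapse {\<gamma>} \<subseteq> generated_submonoid (M \<union> U)"
    using assms(2) unfolding fin_gen_over_def by blast
  obtain V where V: "finite V" "collapse \<Gamma> \<subseteq> generated_submonoid (M \<union> V)"
    using insert.IH unfolding fin_gen_over_def by blast
  let ?G = "generated_submonoid (M \<union> (U \<union> V))"
  have sub: "collapse {\<gamma>} \<subseteq> ?G" "collapse \<Gamma> \<subseteq> ?G"
    using U(2) V(2) generated_submonoid_mono[of "M \<union> U" "M \<union> (U \<union> V)"]
      generated_submonoid_mono[of "M \<union> V" "M \<union> (U \<union> V)"] by blast+
  have "f \<in> ?G" if "f \<in> collapse (insert \<gamma> \<Gamma>)" for f
  proof -
    define f1 where "f1 x = (if f x = \<gamma> then \<gamma> else x)" for x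
    define f2 where "f2 x = (if f x = \<gamma> then x else f x)" for x
    have "f1 \<in> collapse {\<gamma>}" "f2 \<in> collapse \<Gamma>" "f = f2 \<circ> f1"
      using that by (auto simp: collapse_def f1_def f2_def fun_eq_iff)
    then show ?thesis using sub generated_submonoid_closed(2)[of f1 _ f2] by blast
  qed
  with U(1) V(1) show ?case unfolding fin_gen_over_def by (intro exI[of _ "U \<union> V"]) auto
qed

section \<open>Bounds by the models from below and from above\<close>

lemma (in closed_monoid) model_fin_gen_over:
  fixes w :: "nat \<Rightarrow> 'a"
  assumes "bij w" "satisfies c M" "K \<in> model c"
  shows "K \<lessapprox> M"
proof (cases c)
  case I
  then show ?thesis using UNIV_fin_gen_over[OF assms(1)] assms(2,3) by simp
next
  case II
  then obtain S B where S: "finite S" "\<And>\<alpha>. finite (forward_orbit \<alpha> (pw_stabilizer M S))"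
    "\<And>S n. finite S \<Longrightarrow> \<not> orbits_bounded (pw_stabilizer M S) n"
    and K: "K = Pi UNIV B" "\<And>x. finite (B x)"
    using assms(2,3) by auto
  interpret N: closed_monoid "pw_stabilizer M S" using S(1) by (rule closed_monoid_pw_stabilizer)
  have "K \<lessapprox> pw_stabilizer M S"
    unfolding K(1) using assms(1) S(2)
    by (rule N.finite_choices_fin_gen_over) (use S K in \<open>auto simp: pw_stabilizer_pw_stabilizer\<close>)
  also have "\<dots> \<lessapprox> M" by (intro fin_gen_over_subset pw_stabilizer_subset)
  finally show ?thesis .
next
  case III
  then obtain S n B m where S: "finite S" "orbits_bounded (pw_stabilizer M S) n"
    and escape: "\<And>\<Gamma> \<Delta>. finite \<Gamma> \<Longrightarrow> finite \<Delta> \<Longrightarrow>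
      \<exists>\<alpha>. \<not> forward_orbit \<alpha> (pw_stabilizer M \<Delta>) \<subseteq> \<Gamma> \<union> {\<alpha>}"
    and K: "K = Pi UNIV B" "\<And>x. finite (B x) \<and> card (B x) \<le> m"
    using assms(2,3) by auto
  interpret N: closed_monoid "pw_stabilizer M S" using S(1) by (rule closed_monoid_pw_stabilizer)
  have "K \<lessapprox> {f. \<forall>i. f (w i) \<in> {w (2 * i), w (2 * i + 1)}}"
  proof (cases "\<exists>x. B x = {}")
    case True
    then have "K = {}" unfolding K(1) by auto
    then show ?thesis by (simp add: fin_gen_over_finite)
  next
    case False
    have "card (B x) \<le> 2 ^ m" for x using K(2)[of x] less_exp[of m] by linarith
    with False K(2) show ?thesis
      unfolding K(1) by (intro bounded_choices_fin_gen_over_binary[OF assms(1), of B m]) blast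
  qed
  also have "\<dots> \<lessapprox> pw_stabilizer M S"
    using assms(1) S(2)
    by (rule N.binary_choices_fin_gen_over) (use S(1) escape in \<open>auto simp: pw_stabilizer_pw_stabilizer\<close>)
  also have "\<dots> \<lessapprox> M" by (intro fin_gen_over_subset pw_stabilizer_subset)
  finally show ?thesis .
next
  case IV
  then obtain \<Gamma> \<Delta> \<Gamma>' where fin: "finite \<Gamma>" "finite \<Delta>"
    and orbit: "\<And>\<alpha>. forward_orbit \<alpha> (pw_stabilizer M \<Delta>) \<subseteq> \<Gamma> \<union> {\<alpha>}"
    and nontrivial: "\<And>S. finite S \<Longrightarrow> pw_stabilizer M S \<noteq> {id}"
    and K: "K = collapse \<Gamma>'" "finite \<Gamma>'"
    using assms(2,3) by auto
  \<comment> \<open>Stabilizing \<open>\<Gamma>\<close> as well makes it pointwise fixed, while the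
    orbit condition survives.\<close>
  let ?N = "pw_stabilizer M (\<Delta> \<union> \<Gamma>)"
  interpret N: closed_monoid ?N using fin by (intro closed_monoid_pw_stabilizer) simp
  have "collapse {\<delta>} \<lessapprox> ?N" for \<delta>
    using assms(1) fin(1)
  proof (rule N.collapse_singleton_fin_gen_over)
    show "f x = x" if "f \<in> ?N" "x \<in> \<Gamma>" for f x using that by (simp add: pw_stabilizer_def)
    show "forward_orbit \<alpha> ?N \<subseteq> \<Gamma> \<union> {\<alpha>}" for \<alpha>
      using orbit[of \<alpha>] forward_orbit_mono[OF pw_stabilizer_antimono[of \<Delta> "\<Delta> \<union> \<Gamma>"]] by blast
    show "pw_stabilizer ?N S \<noteq> {id}" if "finite S" for S
      using nontrivial fin that by (simp add: pw_stabilizer_pw_stabilizer)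
  qed
  then have "K \<lessapprox> ?N" unfolding K(1) by (rule collapse_fin_gen_over[OF K(2)])
  also have "\<dots> \<lessapprox> M" by (intro fin_gen_over_subset pw_stabilizer_subset)
  finally show ?thesis .
next
  case V
  then show ?thesis using assms(3) id_mem by (simp add: fin_gen_over_subset)
qed

text \<open>Large stabilizers enter here: \<open>M\<close> is generated, up to finitely many maps,
  by a stabilizer whose orbits already fit inside a model.\<close>

lemma fin_gen_over_model:
  assumes "satisfies c M" "large_stabilizers M"
  shows "\<exists>K\<in>model c. M \<lessapprox> K"
proof -
  have stab: "\<exists>K\<in>model c. M \<lessapprox> K" if "finite S" "K \<in> model c" "pw_stabilizer M S \<subseteq> K" for S K
    using assms(2) that fin_gen_over_trans[OF _ fin_gen_over_subset]
    unfolding large_stabilizers_def monoid_equiv_iff by blast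
  show ?thesis
  proof (cases c)
    case I
    then show ?thesis by (auto intro: fin_gen_over_subset)
  next
    case II
    then obtain S where S: "finite S" "\<And>\<alpha>. finite (forward_orbit \<alpha> (pw_stabilizer M S))"
      using assms(1) by auto
    show ?thesis
      by (rule stab[OF S(1), of "Pi UNIV (\<lambda>x. forward_orbit x (pw_stabilizer M S))"])
        (use S(2) II in \<open>auto simp: mem_forward_orbit_iff\<close>)
  next
    case III
    then obtain S n where S: "finite S" "orbits_bounded (pw_stabilizer M S) n"
      using assms(1) by auto
    show ?thesis
      by (rule stab[OF S(1), of "Pi UNIV (\<lambda>x. forward_orbit x (pw_stabilizer M S))"])
        (use S(2) III in \<open>auto simp: mem_forward_orbit_iff orbits_bounded_def\<close>)
  next
    case IV
    then obtain \<Gamma> \<Delta> where fin: "finite \<Gamma>" "finite \<Delta>"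
      and orbit: "\<And>\<alpha>. forward_orbit \<alpha> (pw_stabilizer M \<Delta>) \<subseteq> \<Gamma> \<union> {\<alpha>}"
      using assms(1) by auto
    have "pw_stabilizer M (\<Delta> \<union> \<Gamma>) \<subseteq> collapse \<Gamma>"
    proof
      fix f assume f: "f \<in> pw_stabilizer M (\<Delta> \<union> \<Gamma>)"
      then have "f \<in> pw_stabilizer M \<Delta>" using pw_stabilizer_antimono[of \<Delta> "\<Delta> \<union> \<Gamma>"] by blast
      then have "f x \<in> insert x \<Gamma>" for x using orbit[of x] by (auto simp: forward_orbit_def)
      then show "f \<in> collapse \<Gamma>" using f by (auto simp: collapse_def pw_stabilizer_def)
    qed
    then show ?thesis using fin IV by (intro stab[of "\<Delta> \<union> \<Gamma>" "collapse \<Gamma>"]) auto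
  next
    case V
    then show ?thesis using assms(1) stab by auto
  qed
qed

section \<open>The models are pairwise inequivalent\<close>

fun reach :: "('a \<Rightarrow> 'a set) \<Rightarrow> nat \<Rightarrow> 'a \<Rightarrow> 'a set" where
  "reach B 0 x = {x}"
| "reach B (Suc n) x = reach B n x \<union> \<Union>(B ` reach B n x)"

lemma reach_mono: "m \<le> n \<Longrightarrow> reach B m x \<subseteq> reach B n x"
  by (induction n rule: dec_induct) auto

lemma reach_add: "y \<in> reach B m x \<Longrightarrow> z \<in> reach B n y \<Longrightarrow> z \<in> reach B (m + n) x"
  by (induction n arbitrary: z) auto

text \<open>Here \<open>n\<close> is a word length, the same for all \<open>x\<close>; the diagonal
  maps below violate this uniformity.\<close>

lemma generated_submonoid_reach:
  assumes "X \<subseteq> Pi UNIV B" "f \<in> generated_submonoid X"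
  shows "\<exists>n. \<forall>x. f x \<in> reach B n x"
proof -
  have "generated_submonoid X \<subseteq> {f. \<exists>n. \<forall>x. f x \<in> reach B n x}"
  proof (rule generated_submonoid_least)
    show "X \<subseteq> {f. \<exists>n. \<forall>x. f x \<in> reach B n x}"
    proof
      fix f assume "f \<in> X"
      then have "\<forall>x. f x \<in> reach B (Suc 0) x" using assms(1) by (auto simp: Pi_iff)
      then show "f \<in> {f. \<exists>n. \<forall>x. f x \<in> reach B n x}" by blast
    qed
    show "id \<in> {f. \<exists>n. \<forall>x. f x \<in> reach B n x}" by (auto intro!: exI[of _ 0])
  next
    fix f g assume "f \<in> {f. \<exists>n. \<forall>x. f x \<in> reach B n x}" "g \<in> {f. \<exists>n. \<forall>x. f x \<in> reach B n x}"
    then obtain m n where "\<forall>x. f x \<in> reach B m x" "\<forall>x. g x \<in> reach B n x" by blast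
    then have "\<forall>x. (g \<circ> f) x \<in> reach B (m + n) x" using reach_add[of _ B m _ _ n] by fastforce
    then show "g \<circ> f \<in> {f. \<exists>n. \<forall>x. f x \<in> reach B n x}" by blast
  qed
  with assms(2) show ?thesis by blast
qed

lemma finite_reach: "(\<And>x. finite (B x)) \<Longrightarrow> finite (reach B n x)"
  by (induction n) auto

lemma card_reach:
  assumes "\<And>x. finite (B x) \<and> card (B x) \<le> k"
  shows "card (reach B n x) \<le> Suc k ^ n"
proof (induction n)
  case (Suc n)
  have "card (\<Union>(B ` reach B n x)) \<le> (\<Sum>y\<in>reach B n x. card (B y))"
    using assms by (intro card_UN_le finite_reach) auto
  also have "\<dots> \<le> card (reach B n x) * k" using sum_bounded_above[of "reach B n x" "\<lambda>y. card (B y)" k] assms by simp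
  finally have "card (reach B (Suc n) x) \<le> card (reach B n x) * Suc k"
    using card_Un_le[of "reach B n x" "\<Union>(B ` reach B n x)"] by simp
  also have "\<dots> \<le> Suc k ^ n * Suc k" using Suc.IH by (rule mult_right_mono) simp
  finally show ?case by (simp only: power_Suc2)
qed auto

text \<open>The diagonal map takes at \<open>w n\<close> a value that no word of length
  \<open>n\<close> can reach. The finitely many extra maps are absorbed into the finite sets
  \<open>?C x\<close>.\<close>

lemma UNIV_not_fin_gen_over:
  fixes w :: "nat \<Rightarrow> 'a" and B :: "'a \<Rightarrow> 'a set"
  assumes "bij w" "\<And>x. finite (B x)"
  shows "\<not> UNIV \<lessapprox> Pi UNIV B"
proof
  assume "UNIV \<lessapprox> Pi UNIV B"
  then obtain U where U: "finite U" "UNIV \<subseteq> generated_submonoid (Pi UNIV B \<union> U)"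
    unfolding fin_gen_over_def by blast
  let ?C = "\<lambda>x. B x \<union> (\<lambda>u. u x) ` U"
  have inf: "infinite (UNIV :: 'a set)" using assms(1) bij_betw_finite by blast
  have fin: "finite (reach ?C n x)" for n x using U(1) assms(2) by (intro finite_reach) simp
  define y where "y n x = (SOME y. y \<notin> reach ?C n x)" for n x
  have y: "y n x \<notin> reach ?C n x" for n x
    unfolding y_def by (rule someI_ex, rule ex_new_if_finite[OF inf fin])
  have "\<exists>n. \<forall>x. y (inv_into UNIV w x) x \<in> reach ?C n x"
    by (rule generated_submonoid_reach[of "Pi UNIV B \<union> U"]) (use U(2) in \<open>auto simp: Pi_iff\<close>)
  then obtain n where "y (inv_into UNIV w (w n)) (w n) \<in> reach ?C n (w n)" by blast
  with y show False using assms(1) by (simp add: bij_is_inj)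
qed

text \<open>Words of length \<open>n\<close> reach at most \<open>l ^ n\<close> points for a
  constant \<open>l\<close>, while \<open>n ^ n + 1\<close> values are allowed at
  \<open>w n\<close>; for \<open>n\<close> at least \<open>l\<close> one of them is out of
  reach.\<close>

lemma growing_not_fin_gen_over_bounded:
  fixes w :: "nat \<Rightarrow> 'a" and B :: "'a \<Rightarrow> 'a set"
  assumes "bij w" "\<And>x. finite (B x) \<and> card (B x) \<le> k"
  shows "\<not> Pi UNIV (\<lambda>x. w ` {..inv_into UNIV w x ^ inv_into UNIV w x}) \<lessapprox> Pi UNIV B"
    (is "\<not> Pi UNIV ?G \<lessapprox> _")
proof
  assume "Pi UNIV ?G \<lessapprox> Pi UNIV B"
  then obtain U where U: "finite U" "Pi UNIV ?G \<subseteq> generated_submonoid (Pi UNIV B \<union> U)"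
    unfolding fin_gen_over_def by blast
  let ?C = "\<lambda>x. B x \<union> (\<lambda>u. u x) ` U"
  define l where "l = Suc (k + card U)"
  have C: "finite (?C x) \<and> card (?C x) \<le> k + card U" for x
    using assms(2)[of x] U(1) card_Un_le[of "B x" "(\<lambda>u. u x) ` U"] card_image_le[OF U(1), of "\<lambda>u. u x"] by simp
  have inv: "inv_into UNIV w (w n) = n" for n using assms(1) by (simp add: bij_is_inj)
  have "\<exists>y. y \<in> ?G x \<and> (l \<le> inv_into UNIV w x \<longrightarrow> y \<notin> reach ?C (inv_into UNIV w x) x)" for x
  proof (cases "l \<le> inv_into UNIV w x")
    case True
    let ?n = "inv_into UNIV w x"
    have "card (reach ?C ?n x) \<le> l ^ ?n" unfolding l_def using C by (rule card_reach)
    also have "\<dots> \<le> ?n ^ ?n" using True by (simp add: power_mono)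
    also have "\<dots> < card (?G x)"
      using assms(1) by (simp add: card_image inj_on_subset[OF bij_is_inj])
    finally have less: "card (reach ?C ?n x) < card (?G x)" .
    have fin: "finite (reach ?C ?n x)" using C by (intro finite_reach) blast
    have "\<not> ?G x \<subseteq> reach ?C ?n x"
    proof
      assume "?G x \<subseteq> reach ?C ?n x"
      from card_mono[OF fin this] less show False by linarith
    qed
    then show ?thesis by blast
  qed auto
  from choice[OF allI[OF this]] obtain f where
    f': "\<forall>x. f x \<in> ?G x \<and> (l \<le> inv_into UNIV w x \<longrightarrow> f x \<notin> reach ?C (inv_into UNIV w x) x)" ..
  then have f: "f x \<in> ?G x" "l \<le> inv_into UNIV w x \<Longrightarrow> f x \<notin> reach ?C (inv_into UNIV w x) x" for x
    by blast+
  have "\<exists>n. \<forall>x. f x \<in> reach ?C n x"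
    by (rule generated_submonoid_reach[of "Pi UNIV B \<union> U"]) (use U(2) f(1) in \<open>auto simp: Pi_iff\<close>)
  then obtain n where n: "\<And>x. f x \<in> reach ?C n x" by blast
  let ?m = "max n l"
  have "f (w ?m) \<in> reach ?C ?m (w ?m)" using n[of "w ?m"] reach_mono[of n ?m ?C "w ?m"] by auto
  moreover have "f (w ?m) \<notin> reach ?C ?m (w ?m)" using f(2)[of "w ?m"] inv[of ?m] by simp
  ultimately show False by blast
qed

lemma binary_not_fin_gen_over_collapse:
  fixes w :: "nat \<Rightarrow> 'a"
  assumes "bij w" "finite \<Gamma>"
  shows "\<not> {f. \<forall>i. f (w i) \<in> {w (2 * i), w (2 * i + 1)}} \<lessapprox> collapse \<Gamma>"
proof
  assume "{f. \<forall>i. f (w i) \<in> {w (2 * i), w (2 * i + 1)}} \<lessapprox> collapse \<Gamma>"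
  then obtain U where U: "finite U"
    "{f. \<forall>i. f (w i) \<in> {w (2 * i), w (2 * i + 1)}} \<subseteq> generated_submonoid (collapse \<Gamma> \<union> U)"
    unfolding fin_gen_over_def by blast
  \<comment> \<open>The exceptions are controlled by a finite set of values, not of points: an
    element of \<open>collapse \<Gamma>\<close> may move infinitely many points. This form is closed
    under composition.\<close>
  let ?near = "{f. \<exists>u\<in>generated_submonoid U. \<exists>W. finite W \<and> (\<forall>x. f x = u x \<or> f x \<in> W)}"
  have near: "generated_submonoid (collapse \<Gamma> \<union> U) \<subseteq> ?near"
  proof (rule generated_submonoid_least)
    have "id \<in> generated_submonoid U" by (rule generated_submonoid_closed)
    moreover have "f x = id x \<or> f x \<in> \<Gamma>" if "f \<in> collapse \<Gamma>" for f x
      using that by (auto simp: collapse_def)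
    ultimately have "collapse \<Gamma> \<subseteq> ?near" using assms(2) by blast
    moreover have "U \<subseteq> ?near" using generated_submonoid_incl[of U] by blast
    ultimately show "collapse \<Gamma> \<union> U \<subseteq> ?near" by blast
    show "id \<in> ?near" using generated_submonoid_closed(1)[of U] by blast
  next
    fix f g assume "f \<in> ?near" "g \<in> ?near"
    then obtain u W v X where "u \<in> generated_submonoid U" "finite W" "\<forall>x. f x = u x \<or> f x \<in> W"
      "v \<in> generated_submonoid U" "finite X" "\<forall>x. g x = v x \<or> g x \<in> X" by blast
    then show "g \<circ> f \<in> ?near"
      by (intro CollectI bexI[of _ "v \<circ> u"] exI[of _ "X \<union> g ` W"])
        (auto intro: generated_submonoid_closed, metis imageI)
  qed
  have count: "countable (generated_submonoid U)" using U(1) by (intro countable_generated_submonoid countable_finite)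
  have ne: "generated_submonoid U \<noteq> {}" using generated_submonoid_closed(1) by blast
  \<comment> \<open>The pairing makes every word appear at infinitely many indices, so
    \<open>f\<close> differs from each word at infinitely many points.\<close>
  define u where "u i = from_nat_into (generated_submonoid U) (fst (prod_decode i))" for i
  define f where "f x = (let i = inv_into UNIV w x in
    if u i x = w (2 * i) then w (2 * i + 1) else w (2 * i))" for x
  have inj: "inj w" using assms(1) by (rule bij_is_inj)
  have f: "f (w i) = (if u i (w i) = w (2 * i) then w (2 * i + 1) else w (2 * i))" for i
    by (simp add: f_def inj)
  have "f \<in> {f. \<forall>i. f (w i) \<in> {w (2 * i), w (2 * i + 1)}}" by (simp add: f)
  with U(2) have "f \<in> generated_submonoid (collapse \<Gamma> \<union> U)" by blast
  with near obtain v W where v: "v \<in> generated_submonoid U" "finite W" "\<And>x. f x = v x \<or> f x \<in> W" by blast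
  obtain k where k: "from_nat_into (generated_submonoid U) k = v"
    using v(1) count from_nat_into_surj by metis
  let ?h = "\<lambda>j. w (prod_encode (k, j))"
  have "f (?h j) \<noteq> v (?h j)" for j
    using inj_eq[OF inj] k by (auto simp: f u_def)
  then have "range (\<lambda>j. f (?h j)) \<subseteq> W" using v(3) by blast
  \<comment> \<open>The pairs of values allowed at different indices are disjoint, so the
    exceptional values are infinitely many.\<close>
  moreover have "inj (\<lambda>j. f (?h j))"
  proof (rule injI)
    fix i j assume eq: "f (?h i) = f (?h j)"
    have "\<exists>r\<in>{0, 1}. f (w i) = w (2 * i + r)" for i by (simp add: f)
    then obtain r s where "r \<in> {0, 1}" "s \<in> {0, 1}"
      "2 * prod_encode (k, i) + r = 2 * prod_encode (k, j) + (s :: nat)"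
      using eq by (metis inj_eq[OF inj])
    then have "prod_encode (k, i) = prod_encode (k, j)" by auto presburger+
    then show "i = j" by simp
  qed
  ultimately show False using v(2) finite_subset range_inj_infinite by blast
qed

lemma collapse_not_fin_gen_over_id:
  fixes w :: "nat \<Rightarrow> 'a"
  assumes "bij w"
  shows "\<not> collapse {w 0} \<lessapprox> {id}"
proof
  assume "collapse {w 0} \<lessapprox> {id}"
  then obtain U where U: "finite U" "collapse {w 0} \<subseteq> generated_submonoid ({id} \<union> U)"
    unfolding fin_gen_over_def by blast
  let ?G = "generated_submonoid ({id} \<union> U)"
  have count: "countable ?G" using U(1) by (intro countable_generated_submonoid countable_finite) simp
  \<comment> \<open>The shift by one reserves \<open>w (Suc k)\<close> for defeating word
    \<open>k\<close>, since \<open>w 0\<close> must stay fixed. If that word fixes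
    \<open>w (Suc k)\<close>, then \<open>f\<close> moves it, and conversely.\<close>
  define f where "f x = (if from_nat_into ?G (inv_into UNIV w x - 1) x = x then w 0 else x)" for x
  have inj: "inj w" using assms by (rule bij_is_inj)
  have "f \<in> collapse {w 0}" by (auto simp: collapse_def f_def)
  with U(2) have "f \<in> ?G" by blast
  then obtain k where "from_nat_into ?G k = f" using count from_nat_into_surj by metis
  then have "f (w (Suc k)) = (if f (w (Suc k)) = w (Suc k) then w 0 else w (Suc k))"
    using inj by (subst (1) f_def) simp
  moreover have "w 0 \<noteq> w (Suc k)" using inj by (simp add: inj_eq)
  ultimately show False by (auto split: if_splits)
qed

section \<open>The linear order of the five classes\<close>

fun rank :: "label \<Rightarrow> nat" where
  "rank I = 4" | "rank II = 3" | "rank III = 2" | "rank IV = 1" | "rank V = 0"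

lemma rank_eq_iff: "rank c = rank d \<longleftrightarrow> c = d"
  by (cases c; cases d) auto

lemma rank_less_5: "rank c < 5"
  by (cases c) auto

lemma rank_surj:
  assumes "n < 5"
  obtains c where "rank c = n"
proof -
  have "n = 0 \<or> n = 1 \<or> n = 2 \<or> n = 3 \<or> n = 4" using assms by linarith
  then show ?thesis using that rank.simps by metis
qed

lemma model_Suc_mono:
  assumes "rank d = Suc (rank c)" "K \<in> model c"
  shows "\<exists>L\<in>model d. K \<subseteq> L"
proof (cases c)
  case I
  then show ?thesis using assms(1) by (cases d) auto
next
  case II
  then have "d = I" using assms(1) by (cases d) auto
  then show ?thesis by simp
next
  case III
  then have "d = II" using assms(1) by (cases d) auto
  then have "K \<in> model d" using assms(2) III by auto
  then show ?thesis by blast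
next
  case IV
  then have d: "d = III" using assms(1) by (cases d) auto
  from assms(2) IV obtain \<Gamma> where \<Gamma>: "K = collapse \<Gamma>" "finite \<Gamma>" by auto
  have "card (insert x \<Gamma>) \<le> Suc (card \<Gamma>)" for x using \<Gamma>(2) by (simp add: card_insert_if)
  with \<Gamma>(2) have "Pi UNIV (\<lambda>x. insert x \<Gamma>) \<in> model d" unfolding d by auto
  moreover have "K \<subseteq> Pi UNIV (\<lambda>x. insert x \<Gamma>)" unfolding \<Gamma>(1) collapse_def by auto
  ultimately show ?thesis by blast
next
  case V
  then have "d = IV" using assms(1) by (cases d) auto
  moreover have "K \<subseteq> collapse {}" using assms(2) V by (auto simp: collapse_def)
  ultimately show ?thesis by auto
qed

lemma model_mono:
  assumes "rank c \<le> rank d" "K \<in> model c"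
  shows "\<exists>L\<in>model d. K \<subseteq> L"
proof -
  have "\<forall>d. rank d = n \<longrightarrow> (\<exists>L\<in>model d. K \<subseteq> L)" if "rank c \<le> n" for n
    using that
  proof (induction n rule: dec_induct)
    case base
    then show ?case using assms(2) by (auto simp: rank_eq_iff)
  next
    case (step n)
    show ?case
    proof (intro allI impI)
      fix d assume d: "rank d = Suc n"
      then have "n < 5" using rank_less_5[of d] by simp
      then obtain e where e: "rank e = n" by (rule rank_surj)
      with step.IH obtain L where "L \<in> model e" "K \<subseteq> L" by blast
      moreover from this d e obtain L' where "L' \<in> model d" "L \<subseteq> L'"
        using model_Suc_mono[of d e L] by auto
      ultimately show "\<exists>L\<in>model d. K \<subseteq> L" by blast
    qed
  qed
  with assms(1) show ?thesis by blast
qed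

lemma model_Suc_strict:
  fixes w :: "nat \<Rightarrow> 'a"
  assumes "bij w" "rank d = Suc (rank c)"
  shows "\<exists>L :: ('a \<Rightarrow> 'a) set \<in> model d. \<forall>K\<in>model c. \<not> L \<lessapprox> K"
proof (cases c)
  case I
  then show ?thesis using assms(2) by (cases d) auto
next
  case II
  then have "d = I" using assms(2) by (cases d) auto
  then show ?thesis using UNIV_not_fin_gen_over[OF assms(1)] II by auto
next
  case III
  then have d: "d = II" using assms(2) by (cases d) auto
  let ?L = "Pi UNIV (\<lambda>x. w ` {..inv_into UNIV w x ^ inv_into UNIV w x})"
  have "?L \<in> model d" unfolding d by auto
  moreover have "\<not> ?L \<lessapprox> K" if "K \<in> model c" for K
    using that growing_not_fin_gen_over_bounded[OF assms(1)] III by auto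
  ultimately show ?thesis by blast
next
  case IV
  then have d: "d = III" using assms(2) by (cases d) auto
  let ?i = "inv_into UNIV w"
  let ?B = "\<lambda>x. {w (2 * ?i x), w (2 * ?i x + 1)}"
  have "card (?B x) \<le> 2" for x by (simp add: card_insert_if)
  then have L: "Pi UNIV ?B \<in> model d" unfolding d by auto
  have "(\<forall>x. P x (?i x)) \<longleftrightarrow> (\<forall>i. P (w i) i)" for P :: "'a \<Rightarrow> nat \<Rightarrow> bool"
    using assms(1) by (metis bij_inv_eq_iff)
  from this[of "\<lambda>x i. f x \<in> {w (2 * i), w (2 * i + 1)}" for f]
  have eq: "Pi UNIV ?B = {f. \<forall>i. f (w i) \<in> {w (2 * i), w (2 * i + 1)}}"
    by (simp only: Pi_def UNIV_I simp_thms)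
  have "\<not> Pi UNIV ?B \<lessapprox> K" if "K \<in> model c" for K
    using that binary_not_fin_gen_over_collapse[OF assms(1)] unfolding IV eq by auto
  with L show ?thesis by (intro bexI[of _ "Pi UNIV ?B"]) blast+
next
  case V
  then have "d = IV" using assms(2) by (cases d) auto
  then have "collapse {w 0} \<in> model d" by auto
  then show ?thesis using collapse_not_fin_gen_over_id[OF assms(1)] V by (intro bexI) auto
qed

lemma admissible_iff: "admissible M \<longleftrightarrow> closed_monoid M \<and> large_stabilizers M"
  unfolding admissible_def closed_monoid_iff by blast

lemma fin_gen_over_if_same_label:
  fixes w :: "nat \<Rightarrow> 'a" and M M' :: "('a \<Rightarrow> 'a) set"
  assumes "bij w" "large_stabilizers M" "closed_monoid M'" "satisfies c M" "satisfies c M'"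
  shows "M \<lessapprox> M'"
proof -
  obtain K where "K \<in> model c" "M \<lessapprox> K" using fin_gen_over_model[OF assms(4,2)] by blast
  with closed_monoid.model_fin_gen_over[OF assms(3,1,5)] show ?thesis
    by (blast intro: fin_gen_over_trans)
qed

text \<open>If the rank dropped, the model \<open>L\<close> one rank above \<open>c'\<close> would
  lie below \<open>M\<close>, hence below \<open>M'\<close> and a model of class \<open>c'\<close>,
  against strictness of consecutive ranks.\<close>

lemma rank_mono:
  fixes w :: "nat \<Rightarrow> 'a" and M M' :: "('a \<Rightarrow> 'a) set"
  assumes "bij w" "closed_monoid M" "large_stabilizers M'" "M \<lessapprox> M'" "satisfies c M" "satisfies c' M'"
  shows "rank c \<le> rank c'"
proof (rule ccontr)
  assume "\<not> rank c \<le> rank c'"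
  then have "Suc (rank c') \<le> rank c" by simp
  moreover obtain d where d: "rank d = Suc (rank c')"
    using rank_surj[of "Suc (rank c')"] calculation rank_less_5[of c] by auto
  ultimately have dc: "rank d \<le> rank c" by simp
  obtain K where K: "K \<in> model c'" "M' \<lessapprox> K" using fin_gen_over_model assms(3,6) by blast
  obtain L :: "('a \<Rightarrow> 'a) set" where L: "L \<in> model d" "\<And>K. K \<in> model c' \<Longrightarrow> \<not> L \<lessapprox> K"
    using model_Suc_strict[OF assms(1) d] by blast
  obtain L' where L': "L' \<in> model c" "L \<subseteq> L'" using model_mono[OF dc L(1)] by blast
  have "L \<lessapprox> L'" using L'(2) by (rule fin_gen_over_subset)
  also have "L' \<lessapprox> M" by (rule closed_monoid.model_fin_gen_over[OF assms(2,1,5) L'(1)])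
  also note assms(4)
  also note K(2)
  finally show False using L(2) K(1) by blast
qed

text \<open>The second clause of each middle condition negates the first clause of the next, so the
  five conditions form a chain of case distinctions.\<close>

lemma satisfies_exhaustive: "\<exists>c. satisfies c M"
proof (rule ccontr)
  assume none: "\<not> ?thesis"
  then have not: "\<not> satisfies I M" "\<not> satisfies II M" "\<not> satisfies III M" "\<not> satisfies IV M" "\<not> satisfies V M"
    by blast+
  have "\<exists>S n. finite S \<and> orbits_bounded (pw_stabilizer M S) n" using not(1,2) by auto
  then obtain S n where S: "finite S" "orbits_bounded (pw_stabilizer M S) n" by blast
  \<comment> \<open>Condition III asks for a positive bound.\<close>
  then have "orbits_bounded (pw_stabilizer M S) (Suc n)" by (auto simp: orbits_bounded_def le_Suc_eq)
  with S(1) not(3) have "\<exists>\<Gamma> \<Delta>. finite \<Gamma> \<and> finite \<Delta> \<and>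
      (\<forall>\<alpha>. forward_orbit \<alpha> (pw_stabilizer M \<Delta>) \<subseteq> \<Gamma> \<union> {\<alpha>})"
    unfolding satisfies.simps by blast
  moreover have "\<forall>S. finite S \<longrightarrow> pw_stabilizer M S \<noteq> {id}" using not(5) by auto
  ultimately have "satisfies IV M" unfolding satisfies.simps by (rule conjI)
  with not(4) show False ..
qed

lemma monoid_equiv_iff_label:
  fixes w :: "nat \<Rightarrow> 'a" and M M' :: "('a \<Rightarrow> 'a) set"
  assumes "bij w" "admissible M" "admissible M'" "satisfies c M" "satisfies c' M'"
  shows "monoid_equiv M M' \<longleftrightarrow> c = c'"
proof
  assume "monoid_equiv M M'"
  then have "rank c \<le> rank c'" "rank c' \<le> rank c"
    using rank_mono[OF assms(1)] assms(2-5) unfolding monoid_equiv_iff admissible_iff by blast+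
  then show "c = c'" by (simp add: rank_eq_iff[symmetric])
next
  assume "c = c'"
  then show "monoid_equiv M M'"
    using fin_gen_over_if_same_label[OF assms(1)] assms(2-5) unfolding monoid_equiv_iff admissible_iff by blast
qed

section \<open>All five conditions occur\<close>

text \<open>All conditions speak of stabilizers of arbitrary or suitable finite sets, and
  \<open>S\<close> can be added to such a set.\<close>

lemma (in closed_monoid) satisfies_pw_stabilizer:
  assumes "satisfies c M" "finite S"
  shows "satisfies c (pw_stabilizer M S)"
proof (cases c)
  case I
  then show ?thesis using assms by (simp add: pw_stabilizer_pw_stabilizer)
next
  case II
  then obtain T where T: "finite T" "\<And>\<alpha>. finite (forward_orbit \<alpha> (pw_stabilizer M T))"
    using assms(1) by auto
  have "finite (forward_orbit \<alpha> (pw_stabilizer M (S \<union> T)))" for \<alpha>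
    using finite_subset[OF forward_orbit_mono[OF pw_stabilizer_antimono[of T "S \<union> T"]] T(2)] by simp
  then show ?thesis using II assms T(1) by (auto simp: pw_stabilizer_pw_stabilizer)
next
  case III
  then obtain T n where T: "finite T" "n > 0" "orbits_bounded (pw_stabilizer M T) n"
    using assms(1) by auto
  have sub: "forward_orbit \<alpha> (pw_stabilizer M (S \<union> T)) \<subseteq> forward_orbit \<alpha> (pw_stabilizer M T)" for \<alpha>
    by (intro forward_orbit_mono pw_stabilizer_antimono) auto
  have "orbits_bounded (pw_stabilizer M (S \<union> T)) n"
    using T(3) card_mono[OF _ sub] finite_subset[OF sub] unfolding orbits_bounded_def
    by (meson order_trans)
  then show ?thesis using III assms T(1,2) by (auto simp: pw_stabilizer_pw_stabilizer)
next
  case IV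
  then obtain \<Gamma> \<Delta> where fin: "finite \<Gamma>" "finite \<Delta>"
    and orbit: "\<And>\<alpha>. forward_orbit \<alpha> (pw_stabilizer M \<Delta>) \<subseteq> \<Gamma> \<union> {\<alpha>}"
    using assms(1) by auto
  have "forward_orbit \<alpha> (pw_stabilizer M (S \<union> \<Delta>)) \<subseteq> \<Gamma> \<union> {\<alpha>}" for \<alpha>
    using forward_orbit_mono[OF pw_stabilizer_antimono[of \<Delta> "S \<union> \<Delta>"]] orbit[of \<alpha>] by blast
  with fin have "\<exists>\<Gamma> \<Delta>. finite \<Gamma> \<and> finite \<Delta> \<and>
      (\<forall>\<alpha>. forward_orbit \<alpha> (pw_stabilizer (pw_stabilizer M S) \<Delta>) \<subseteq> \<Gamma> \<union> {\<alpha>})"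
    unfolding pw_stabilizer_pw_stabilizer by blast
  then show ?thesis using IV assms by (auto simp: pw_stabilizer_pw_stabilizer)
next
  case V
  then obtain T where T: "finite T" "pw_stabilizer M T = {id}" using assms(1) by auto
  have "pw_stabilizer M (S \<union> T) = {id}"
    using T(2) pw_stabilizer_antimono[of T "S \<union> T" M] id_mem by (auto simp: pw_stabilizer_def)
  with T(1) V show ?thesis by (auto simp: pw_stabilizer_pw_stabilizer)
qed

text \<open>Large stabilizers come from the lower bound: a stabilizer satisfies the same condition,
  hence generates \<open>K\<close> and with it \<open>M\<close>, up to finitely many maps.\<close>

lemma admissible_if_subset_model:
  fixes w :: "nat \<Rightarrow> 'a" and M :: "('a \<Rightarrow> 'a) set"
  assumes "bij w" "closed_monoid M" "satisfies c M" "K \<in> model c" "M \<subseteq> K"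
  shows "admissible M"
  unfolding admissible_iff large_stabilizers_def monoid_equiv_iff
proof (intro conjI allI impI assms(2))
  fix S :: "'a set" assume S: "finite S"
  interpret closed_monoid M by (rule assms(2))
  show "pw_stabilizer M S \<lessapprox> M" by (intro fin_gen_over_subset pw_stabilizer_subset)
  have "M \<lessapprox> K" using assms(5) by (rule fin_gen_over_subset)
  also have "K \<lessapprox> pw_stabilizer M S"
    using closed_monoid_pw_stabilizer[OF S] assms(1) satisfies_pw_stabilizer[OF assms(3) S] assms(4)
    by (rule closed_monoid.model_fin_gen_over)
  finally show "M \<lessapprox> pw_stabilizer M S" .
qed

text \<open>Membership \<open>y \<in> B x\<close> is a preorder, and \<open>Pi UNIV B\<close>
  consists of the maps that send each point to a point related to it. The examples for all five
  classes have this form.\<close>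

locale preorder_family =
  fixes B :: "'a \<Rightarrow> 'a set"
  assumes refl: "x \<in> B x" and trans: "y \<in> B x \<Longrightarrow> B y \<subseteq> B x"
begin

lemma closed_monoid_Pi: "closed_monoid (Pi UNIV B)"
proof
  show "id \<in> Pi UNIV B" using refl by auto
  show "g \<circ> f \<in> Pi UNIV B" if "f \<in> Pi UNIV B" "g \<in> Pi UNIV B" for f g
    using that trans by (fastforce simp: Pi_iff)
  show "f \<in> Pi UNIV B" if f: "\<And>F. finite F \<Longrightarrow> \<exists>g\<in>Pi UNIV B. \<forall>x\<in>F. g x = f x" for f
  proof
    fix x
    obtain g where g: "g \<in> Pi UNIV B" "g x = f x" using f[of "{x}"] by auto
    from g(1) have "g x \<in> B x" by auto
    with g(2) show "f x \<in> B x" by simp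
  qed
  show "\<exists>g\<in>Pi UNIV B. ae_injective g \<and> (\<forall>x\<in>F. g x = f x)"
    if f: "f \<in> Pi UNIV B" and F: "finite F" for f F
  proof (intro bexI conjI)
    \<comment> \<open>Only the values on \<open>F\<close> matter, so the map is made the identity
      elsewhere and is injective off \<open>F\<close>.\<close>
    let ?g = "\<lambda>x. if x \<in> F then f x else x"
    show "?g \<in> Pi UNIV B" using f refl by auto
    show "ae_injective ?g" unfolding ae_injective_def using F by (intro exI[of _ F]) (auto simp: inj_on_def)
  qed auto
qed

lemma forward_orbit_Pi:
  "forward_orbit \<alpha> (pw_stabilizer (Pi UNIV B) S) = (if \<alpha> \<in> S then {\<alpha>} else B \<alpha>)"
proof -
  have "\<beta> \<in> forward_orbit \<alpha> (pw_stabilizer (Pi UNIV B) S)" if "\<alpha> \<notin> S" "\<beta> \<in> B \<alpha>" for \<beta>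
    unfolding mem_forward_orbit_iff using that refl
    by (intro bexI[of _ "id(\<alpha> := \<beta>)"]) (auto simp: pw_stabilizer_def)
  moreover have "\<alpha> \<in> forward_orbit \<alpha> (pw_stabilizer (Pi UNIV B) S)"
    unfolding mem_forward_orbit_iff using refl by (intro bexI[of _ id]) (auto simp: pw_stabilizer_def)
  ultimately show ?thesis by (auto simp: forward_orbit_def pw_stabilizer_def)
qed

end

lemma exists_admissible:
  fixes w :: "nat \<Rightarrow> 'a"
  assumes "bij w"
  shows "\<exists>M :: ('a \<Rightarrow> 'a) set. admissible M \<and> satisfies c M"
proof -
  define j where "j = inv_into UNIV w"
  have j: "w (j x) = x" "j (w i) = i" for x i
    using assms by (simp_all add: j_def bij_is_surj surj_f_inv_f bij_is_inj)
  have w_eq: "w i = w k \<longleftrightarrow> i = k" for i k using assms by (simp add: bij_is_inj inj_eq)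
  have infinite: "infinite (UNIV :: 'a set)" using assms bij_betw_finite by blast
  have large: "\<exists>n\<ge>m. \<forall>k\<ge>n. w k \<notin> S" if S: "finite S" for S m
  proof -
    obtain n where n: "j ` S \<subseteq> {..<n}" 
      using finite_imageI[OF S, of j] unfolding finite_nat_iff_bounded ..
    have "w k \<notin> S" if "k \<ge> max m n" for k
    proof
      assume "w k \<in> S"
      with n have "j (w k) \<in> {..<n}" by blast
      with that show False by (simp add: j)
    qed
    then show ?thesis by (intro exI[of _ "max m n"]) simp
  qed
  have main: "\<exists>M :: ('a \<Rightarrow> 'a) set. admissible M \<and> satisfies c M"
    if "preorder_family B" "satisfies c (Pi UNIV B)" "K \<in> model c" "Pi UNIV B \<subseteq> K"
    for B :: "'a \<Rightarrow> 'a set" and K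
    using admissible_if_subset_model[OF assms preorder_family.closed_monoid_Pi[OF that(1)] that(2-4)] that(2)
    by blast
  show ?thesis
  proof (cases c)
    case I
    interpret preorder_family "\<lambda>_. UNIV :: 'a set" by standard auto
    have "\<exists>\<alpha>. infinite (forward_orbit \<alpha> (pw_stabilizer (Pi UNIV (\<lambda>_. UNIV)) S))" if S: "finite S" for S :: "'a set"
    proof -
      obtain a where "a \<notin> S" using ex_new_if_finite[OF infinite S] ..
      then show ?thesis unfolding forward_orbit_Pi using infinite by (intro exI[of _ a]) simp
    qed
    then have "satisfies c (Pi UNIV (\<lambda>_ :: 'a. UNIV :: 'a set))" unfolding I satisfies.simps by blast
    then show ?thesis by (rule main[OF preorder_family_axioms, where K = UNIV]) (auto simp: I)
  next
    case II
    \<comment> \<open>Points may move back along the enumeration: the orbit of \<open>w k\<close> is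
      finite, but of size \<open>k + 1\<close>.\<close>
    let ?B = "\<lambda>x. w ` {..j x}"
    interpret preorder_family ?B
    proof
      show "x \<in> ?B x" for x by (rule image_eqI[where x = "j x"]) (simp_all add: j)
    qed (auto simp: j)
    have "\<not> orbits_bounded (pw_stabilizer (Pi UNIV ?B) S) n" if S: "finite S" for S n
    proof
      assume "orbits_bounded (pw_stabilizer (Pi UNIV ?B) S) n"
      moreover obtain k where k: "k \<ge> n" "w k \<notin> S" using large[OF S, of n] by blast
      ultimately have "card (?B (w k)) \<le> n" unfolding orbits_bounded_def by (metis forward_orbit_Pi)
      moreover have "card (?B (w k)) = Suc k"
        using assms by (simp add: j card_image inj_on_subset[OF bij_is_inj])
      ultimately show False using k(1) by simp
    qed
    moreover have "finite (forward_orbit \<alpha> (pw_stabilizer (Pi UNIV ?B) {}))" for \<alpha> by (simp add: forward_orbit_Pi)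
    ultimately have "satisfies c (Pi UNIV ?B)" unfolding II satisfies.simps by blast
    then show ?thesis by (rule main[OF preorder_family_axioms, where K = "Pi UNIV ?B"]) (auto simp: II)
  next
    case III
    \<comment> \<open>The points are grouped into blocks of two, within which a map may move them
      freely.\<close>
    let ?B = "\<lambda>x. {w (2 * (j x div 2)), w (Suc (2 * (j x div 2)))}"
    interpret preorder_family ?B
    proof
      fix x
      have "j x = 2 * (j x div 2) \<or> j x = Suc (2 * (j x div 2))" by presburger
      then show "x \<in> ?B x" using j(1)[of x] by (metis insert_iff)
    qed (auto simp: j)
    have card: "card (?B x) \<le> 2" for x by (simp add: card_insert_if)
    have "orbits_bounded (pw_stabilizer (Pi UNIV ?B) {}) 2"
      using card by (simp add: orbits_bounded_def forward_orbit_Pi)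
    moreover have "\<exists>\<alpha>. \<not> forward_orbit \<alpha> (pw_stabilizer (Pi UNIV ?B) \<Delta>) \<subseteq> \<Gamma> \<union> {\<alpha>}"
      if fin: "finite \<Gamma>" "finite \<Delta>" for \<Gamma> \<Delta>
    proof -
      obtain n where n: "\<And>k. k \<ge> n \<Longrightarrow> w k \<notin> \<Gamma> \<union> \<Delta>" using large[of "\<Gamma> \<union> \<Delta>"] fin by auto
      have "w (2 * n + 1) \<in> forward_orbit (w (2 * n)) (pw_stabilizer (Pi UNIV ?B) \<Delta>)"
        using n[of "2 * n"] by (simp add: forward_orbit_Pi j)
      moreover have "w (2 * n + 1) \<notin> \<Gamma> \<union> {w (2 * n)}" using n[of "2 * n + 1"] by (simp add: w_eq)
      ultimately show ?thesis by blast
    qed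
    ultimately have "satisfies c (Pi UNIV ?B)" unfolding III satisfies.simps
      by (intro conjI allI impI exI[of _ "{}"] exI[of _ 2]) auto
    moreover have "Pi UNIV ?B \<in> model c" unfolding III using card by auto
    ultimately show ?thesis using main[OF preorder_family_axioms] by blast
  next
    case IV
    let ?B = "\<lambda>x. {x, w 0}"
    interpret preorder_family ?B by standard auto
    have "pw_stabilizer (Pi UNIV ?B) S \<noteq> {id}" if S: "finite S" for S
    proof
      assume id: "pw_stabilizer (Pi UNIV ?B) S = {id}"
      obtain a where a: "a \<notin> insert (w 0) S" using ex_new_if_finite[OF infinite, of "insert (w 0) S"] S by auto
      then have "w 0 \<in> forward_orbit a (pw_stabilizer (Pi UNIV ?B) S)" by (simp add: forward_orbit_Pi)
      then show False using a unfolding id by (auto simp: forward_orbit_def)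
    qed
    moreover have "forward_orbit \<alpha> (pw_stabilizer (Pi UNIV ?B) {}) \<subseteq> {w 0} \<union> {\<alpha>}" for \<alpha>
      by (simp add: forward_orbit_Pi)
    ultimately have "satisfies c (Pi UNIV ?B)" unfolding IV satisfies.simps
      by (intro conjI allI impI exI[of _ "{}"] exI[of _ "{w 0}"]) auto
    moreover have "collapse {w 0} \<in> model c" unfolding IV by auto
    moreover have "Pi UNIV ?B \<subseteq> collapse {w 0}" by (auto simp: collapse_def Pi_iff)
    ultimately show ?thesis using main[OF preorder_family_axioms] by blast
  next
    case V
    interpret preorder_family "\<lambda>x :: 'a. {x}" by standard auto
    have id: "Pi UNIV (\<lambda>x :: 'a. {x}) = {id}" by (auto simp: Pi_iff fun_eq_iff)
    have "pw_stabilizer {id} {} = {id :: 'a \<Rightarrow> 'a}" by (auto simp: pw_stabilizer_def)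
    then have "satisfies c (Pi UNIV (\<lambda>x :: 'a. {x}))" unfolding V id by auto
    then show ?thesis by (rule main[OF preorder_family_axioms, where K = "{id}"]) (simp_all add: V id)
  qed
qed

theorem theorem41:
  assumes "countable (UNIV :: 'a set)" and "infinite (UNIV :: 'a set)"
  shows "(\<forall>M :: ('a \<Rightarrow> 'a) set. admissible M \<longrightarrow> (\<exists>!c. satisfies c M)) \<and>
    (\<forall>M M' :: ('a \<Rightarrow> 'a) set. admissible M \<and> admissible M' \<longrightarrow>
       (monoid_equiv M M' \<longleftrightarrow> (\<exists>c. satisfies c M \<and> satisfies c M'))) \<and>
    card ({M :: ('a \<Rightarrow> 'a) set. admissible M} //
      {(M, M'). admissible M \<and> admissible M' \<and> monoid_equiv M M'}) = 5"
proof -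
  define w :: "nat \<Rightarrow> 'a" where "w = from_nat_into UNIV"
  have w: "bij w" unfolding w_def using bij_betw_from_nat_into[OF assms] .
  \<comment> \<open>Uniqueness of the label is the case of a monoid compared with itself.\<close>
  have unique: "c = c'" if "admissible M" "satisfies c M" "satisfies c' M" for M :: "('a \<Rightarrow> 'a) set" and c c'
    using monoid_equiv_iff_label[OF w that(1,1,2,3)] fin_gen_over_subset[of M M] by (simp add: monoid_equiv_iff)
  have equiv: "monoid_equiv M M' \<longleftrightarrow> (\<exists>c. satisfies c M \<and> satisfies c M')"
    if "admissible M" "admissible M'" for M M' :: "('a \<Rightarrow> 'a) set"
    using monoid_equiv_iff_label[OF w that] satisfies_exhaustive unique that by metis
  let ?X = "{M :: ('a \<Rightarrow> 'a) set. admissible M}"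
  let ?r = "{(M :: ('a \<Rightarrow> 'a) set, M'). admissible M \<and> admissible M' \<and> monoid_equiv M M'}"
  define C where "C c = {M :: ('a \<Rightarrow> 'a) set. admissible M \<and> satisfies c M}" for c
  \<comment> \<open>The class of \<open>M\<close> is the set of all admissible monoids with the
    label of \<open>M\<close>, which identifies the quotient with the set of labels.\<close>
  have cls: "?r `` {M} = C c" if "admissible M" "satisfies c M" for M c
    using that equiv unique unfolding C_def by blast
  have "?X // ?r = range C"
  proof safe
    fix Y assume "Y \<in> ?X // ?r"
    then obtain M where "admissible M" "Y = ?r `` {M}" by (auto elim: quotientE)
    then show "Y \<in> range C" using cls satisfies_exhaustive[of M] by blast
  next
    fix c
    obtain M :: "('a \<Rightarrow> 'a) set" where M: "admissible M" "satisfies c M" using exists_admissible[OF w] by blast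
    then have "?r `` {M} \<in> ?X // ?r" by (intro quotientI) simp
    then show "C c \<in> ?X // ?r" using cls[OF M] by simp
  qed
  moreover have "inj C"
  proof (rule injI)
    fix c c' assume "C c = C c'"
    moreover obtain M :: "('a \<Rightarrow> 'a) set" where "admissible M" "satisfies c M"
      using exists_admissible[OF w] by blast
    ultimately show "c = c'" using unique unfolding C_def by blast
  qed
  moreover have "card (UNIV :: label set) = 5"
  proof -
    have labels: "(UNIV :: label set) = {I, II, III, IV, V}" using label.exhaust by auto
    show ?thesis unfolding labels by simp
  qed
  ultimately have "card (?X // ?r) = 5" by (simp add: card_image)
  moreover have "\<exists>!c. satisfies c M" if "admissible M" for M :: "('a \<Rightarrow> 'a) set"
    using satisfies_exhaustive unique[OF that] by blast
  ultimately show ?thesis using equiv by blast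
qed

end
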